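(* Let $\kappa,a,\beta>0$, and let $\mathbf H$ be the classical lattice physical Hamiltonian defined in the context with the Alesci-Assanioussi-Lewandowski-Makinen constraint $C_v=-\frac{1}{\beta^2}C_{0,v}-\frac{1+\beta^2}{\kappa\beta^2}\,{}^3\!\mathcal R_v$. Consider, for differentiable functions $\theta(\tau)\in\mathbb R$, $p(\tau)>0$ with $\sin\theta\neq0$, the cosmological evolution equations $$\frac{d\theta}{d\tau}=-\frac{\kappa}{a^2}\frac{\partial \mathbf H}{\partial\,\delta p_\parallel(e_I(v))}\Big|_{\delta\theta=\delta p=0},\qquad \frac{dp}{d\tau}=\frac{\kappa}{a^2}\frac{\partial \mathbf H}{\partial\,\delta \theta_\parallel(e_I(v))}\Big|_{\delta\theta=\delta p=0}\qquad\text{for all } I, v,\tag{E}$$ and the constraint equations $$\frac{\partial \mathbf H}{\partial\,\delta p^b_\bot(e_I(v))}\Big|_{\delta\theta=\delta p=0}=0,\qquad \frac{\partial \mathbf H}{\partial\,\delta \theta^b_\bot(e_I(v))}\Big|_{\delta\theta=\delta p=0}=0\qquad\text{for all } I,v \text{ and } b\neq I.\tag{C}$$ (i) For $\mathbf H=\mathbf H_{dust}$, in both the Brown-Kuchař ($\alpha=1$) and Gaussian ($\alpha=0$) dust models, (E) is equivalent to $$\frac{d\theta}{d\tau}=-\frac{\partial}{\partial p}\left[\frac{4}{3\beta^2a}\sqrt{2\beta p}\,\sin^2\theta\right],\qquad \frac{dp}{d\tau}=\frac{\partial}{\partial\theta}\left[\frac{4}{3\beta^2a}\sqrt{2\beta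 p}\,\sin^2\theta\right],$$ and (C) is satisfied automatically. (ii) For $\mathbf H=\mathbf H_{scalar}$ (gravity-scalar model), (E) is equivalent to $$\frac{d\theta}{d\tau}=-\frac{\partial}{\partial p}\left[\frac{\sqrt{2\kappa}\,p}{3}\sqrt{\sin^2\theta}\right],\qquad \frac{dp}{d\tau}=\frac{\partial}{\partial\theta}\left[\frac{\sqrt{2\kappa}\,p}{3}\sqrt{\sin^2\theta}\right],$$ and (C) is satisfied automatically.
   Context: Conventions: $\tau^a=\tau_a=-i\sigma^a$ ($\sigma^a$ Pauli matrices, $a=1,2,3$), $\tau_0=1_{2\times2}$; repeated su(2) indices are summed. Lattice: $\gamma$ is the periodic cubic lattice with vertex set $V(\gamma)=(\mathbb Z/L)^3$ ($L\ge2$, so the six edges at a vertex are distinct), oriented edges $e_I(v)$ from $v$ to $v+\hat I$, $I=1,2,3$. Write $e_{v;I+}=e_I(v)$ and $e_{v;I-}=e_I(v-\hat I)^{-1}$ (both start at $v$). Phase space: each edge $e$ carries $h(e)\in SU(2)$ and $p(e)=(p^a(e))\in\mathbb R^3$, with Poisson brackets $\{h(e),h(e')\}=0$, $\{p^a(e),h(e')\}=\frac{\kappa}{a^2}\delta_{e,e'}\frac{\tau^a}{2}h(e')$, $\{p^a(e),p^b(e')\}=-\frac{\kappa}{a^2}\delta_{e,e'}\epsilon_{abc}p^c(e')$. For reversed edges $h(e^{-1})=h(e)^{-1}$, $p^a(e^{-1})=\frac12\mathrm{Tr}[\tau^a h(e)^{-1}p^b(e)\tau^b h(e)]$. For signs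 $s,s'=\pm1$ and $I\ne J$, the square-loop holonomy is $h(\alpha_{v;Is,Js'})=h(e_{v;Is})\,h(e_{v+s\hat I;Js'})\,h(e_{v+s'\hat J;Is})^{-1}\,h(e_{v;Js'})^{-1}$. Volume: $V_v=|Q_v|^{1/2}$, $Q_v=\left(\frac{\beta a^2}{2}\right)^3\epsilon_{abc}X_1^aX_2^bX_3^c$, $X_I^a=\frac12\left(p^a(e_{v;I+})-p^a(e_{v;I-})\right)$. Constraints, for $\mu=0,1,2,3$ (with $j$ denoting $\mu=1,2,3$): $$C_{\mu,v}=-\frac{8}{3\beta\kappa^2}\sum_{s_1,s_2,s_3=\pm1}\ \sum_{I_1,I_2,I_3}s_1s_2s_3\,\epsilon^{I_1I_2I_3}\,\mathrm{Tr}\Big(\tau_\mu\,h(\alpha_{v;I_1s_1,I_2s_2})\,h(e_{v;I_3s_3})\{h(e_{v;I_3s_3})^{-1},V_v\}\Big).$$ Lattice scalar curvature (Regge type; each edge of the dual cubic lattice is shared by $4$ cells): $${}^3\!\mathcal R_v=\sum_{I\neq J}\sum_{s_1,s_2=\pm1}L_v(I,s_1;J,s_2)\left(\frac{2\pi}{4}-\pi+\arccos\left[\frac{\vec p(e_{v;Is_1})\cdot\vec p(e_{v;Js_2})}{|\vec p(e_{v;Is_1})|\,|\vec p(e_{v;Js_2})|}\right]\right),\qquad L_v(I,s_1;J,s_2)=\frac{1}{V_v}\big|\vec p(e_{v;Is_1})\times\vec p(e_{v;Js_2})\big|.$$ Physical Hamiltonians built from $C_v$: $\mathbf H_{dust}=\sum_{v}\big|C_v^2-\frac{\alpha}{4}\sum_{j=1}^3C_{j,v}^2\big|^{1/2}$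 with $\alpha=1$ (Brown-Kuchař dust) or $\alpha=0$ (Gaussian dust), and $\mathbf H_{scalar}=\sum_v|V_vC_v|^{1/2}$. Perturbed homogeneous isotropic data: given constants $\theta\in\mathbb R$, $p>0$, $\mathbf H$ is regarded as a function of independent real perturbations by evaluating it at $p^b(e_I(v))=[p+\delta p_\parallel(e_I(v))]\delta^b_I+\delta p_\bot^b(e_I(v))$ and $h(e_I(v))=e^{\theta^b(e_I(v))\tau^b/2}$ with $\theta^b(e_I(v))=[\theta+\delta\theta_\parallel(e_I(v))]\delta^b_I+\delta\theta^b_\bot(e_I(v))$, where $\delta p_\bot^I(e_I(v))=\delta\theta_\bot^I(e_I(v))=0$. "$\delta\theta=\delta p=0$" means all perturbations vanish. *)

theory Defs
  imports "HOL-Analysis.Analysis" "Berlekamp_Zassenhaus.Finite_Field"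
begin

section \<open>Lattice\<close>

text \<open>
  The lattice \<open>(\<int>/L)\<^sup>3\<close> is \<open>('l mod_ring)^3\<close> with \<open>L = CARD('l)\<close>; the class \<open>nontriv\<close> says
  \<open>CARD('l) > 1\<close>, i.e. \<open>L \<ge> 2\<close>.  The pair \<open>(v, I)\<close> is the edge \<open>e\<^sub>I(v)\<close> from \<open>v\<close> to
  \<open>v + axis I 1\<close>.  In the type \<open>3\<close> the elements are \<open>1\<close>, \<open>2\<close>, \<open>3\<close> (with \<open>3 = 0\<close>).
\<close>

type_synonym 'l vertex = "('l mod_ring) ^ 3"
type_synonym 'l edge = "'l vertex \<times> 3"

datatype 'l oriented_edge = Fwd "'l edge" | Rev "'l edge"

definition shift :: "'l::nontriv vertex \<Rightarrow> 3 \<Rightarrow> int \<Rightarrow> 'l vertex" where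
  "shift v I s = v + axis I (of_int s)"

text \<open>The edge \<open>e\<^bsub>v;Is\<^esub>\<close> starting at \<open>v\<close>, for a sign \<open>s \<in> {1, -1}\<close>.\<close>

definition edge_at :: "'l::nontriv vertex \<Rightarrow> 3 \<Rightarrow> int \<Rightarrow> 'l oriented_edge" where
  "edge_at v I s = (if s = 1 then Fwd (v, I) else Rev (shift v I (-1), I))"

abbreviation signs :: "int set" where "signs \<equiv> {1, -1}"

definition levi_civita :: "3 \<Rightarrow> 3 \<Rightarrow> 3 \<Rightarrow> real" where
  "levi_civita a b c =
     (if (a, b, c) \<in> {(1, 2, 3), (2, 3, 1), (3, 1, 2)} then 1
      else if (a, b, c) \<in> {(1, 3, 2), (3, 2, 1), (2, 1, 3)} then -1 else 0)"


section \<open>Matrices\<close>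

definition pauli :: "3 \<Rightarrow> complex^2^2" where
  "pauli a =
     (if a = 1 then vector [vector [0, 1], vector [1, 0]]
      else if a = 2 then vector [vector [0, -\<i>], vector [\<i>, 0]]
      else vector [vector [1, 0], vector [0, -1]])"

definition tau :: "3 \<Rightarrow> complex^2^2" where
  "tau a = (\<chi> i j. -\<i> * pauli a $ i $ j)"

text \<open>The matrix exponential (the componentwise product of \<open>complex^2^2\<close> is not the matrix
  product, so \<open>exp\<close> does not apply).\<close>

definition mexp :: "complex^2^2 \<Rightarrow> complex^2^2" where
  "mexp A = (\<Sum>n. (1 / fact n) *\<^sub>R (((**) A) ^^ n) (mat 1))"

definition su2_vec :: "real^3 \<Rightarrow> complex^2^2" where
  "su2_vec w = (\<Sum>b\<in>UNIV. (w $ b) *\<^sub>R tau b)"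


section \<open>Phase space\<close>

text \<open>
  A point is a pair \<open>(h, p)\<close>.  The matrices \<open>h e\<close> are not constrained to \<open>SU(2)\<close> by the type; all
  configurations considered below have \<open>h e \<in> SU(2)\<close>, and the Poisson bracket differentiates
  only along directions tangent to \<open>SU(2)\<close>.
\<close>

type_synonym 'l phase = "('l edge \<Rightarrow> complex^2^2) \<times> ('l edge \<Rightarrow> real^3)"

fun hol :: "'l phase \<Rightarrow> 'l oriented_edge \<Rightarrow> complex^2^2" where
  "hol x (Fwd e) = fst x e"
| "hol x (Rev e) = matrix_inv (fst x e)"

text \<open>For \<open>h e \<in> SU(2)\<close> the trace below is real, so that \<open>Re\<close> only changes the type.\<close>

fun flux :: "'l phase \<Rightarrow> 'l oriented_edge \<Rightarrow> real^3" where
  "flux x (Fwd e) = snd x e"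
| "flux x (Rev e) =
     (\<chi> a. Re (trace (tau a ** matrix_inv (fst x e) ** su2_vec (snd x e) ** fst x e)) / 2)"

text \<open>
  The Poisson bracket as a biderivation.  The field \<open>d/dt F(exp (t \<tau>\<^sup>b/2) h(e))\<close> is the one
  attached to \<open>{p\<^sup>b(e), -}\<close> by the fundamental bracket
  \<open>{p\<^sup>b(e), h(e)} = \<kappa>/a\<^sup>2 \<tau>\<^sup>b/2 h(e)\<close>.
\<close>

definition deriv_flux :: "('l phase \<Rightarrow> complex) \<Rightarrow> 'l edge \<Rightarrow> 3 \<Rightarrow> 'l phase \<Rightarrow> complex" where
  "deriv_flux F e b x =
     vector_derivative (\<lambda>t. F (fst x, (snd x)(e := snd x e + axis b t))) (at 0)"

definition deriv_hol :: "('l phase \<Rightarrow> complex) \<Rightarrow> 'l edge \<Rightarrow> 3 \<Rightarrow> 'l phase \<Rightarrow> complex" where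
  "deriv_hol F e b x =
     vector_derivative (\<lambda>t. F ((fst x)(e := mexp ((t / 2) *\<^sub>R tau b) ** fst x e), snd x)) (at 0)"

definition poisson ::
    "real \<Rightarrow> real \<Rightarrow> ('l::nontriv phase \<Rightarrow> complex) \<Rightarrow> ('l phase \<Rightarrow> complex) \<Rightarrow> 'l phase \<Rightarrow> complex"
  where
  "poisson \<kappa> a F G x = of_real (\<kappa> / a\<^sup>2) *
     (\<Sum>e\<in>UNIV.
        (\<Sum>b\<in>UNIV. deriv_flux F e b x * deriv_hol G e b x - deriv_hol F e b x * deriv_flux G e b x)
      - (\<Sum>b\<in>UNIV. \<Sum>c\<in>UNIV. \<Sum>d\<in>UNIV. of_real (levi_civita b c d * snd x e $ d)
            * deriv_flux F e b x * deriv_flux G e c x))"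

text \<open>The square loop \<open>\<alpha>\<^bsub>v;Is,Js'\<^esub>\<close>.\<close>

definition loop_hol ::
    "'l::nontriv phase \<Rightarrow> 'l vertex \<Rightarrow> 3 \<Rightarrow> int \<Rightarrow> 3 \<Rightarrow> int \<Rightarrow> complex^2^2" where
  "loop_hol x v I s J s' =
     hol x (edge_at v I s) ** hol x (edge_at (shift v I s) J s')
     ** matrix_inv (hol x (edge_at (shift v J s') I s)) ** matrix_inv (hol x (edge_at v J s'))"


section \<open>Volume, constraints, curvature\<close>

definition flux_avg :: "'l::nontriv phase \<Rightarrow> 'l vertex \<Rightarrow> 3 \<Rightarrow> real^3" where
  "flux_avg x v I = (1 / 2) *\<^sub>R (flux x (edge_at v I 1) - flux x (edge_at v I (-1)))"

definition Qvol :: "real \<Rightarrow> real \<Rightarrow> 'l::nontriv vertex \<Rightarrow> 'l phase \<Rightarrow> real" where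
  "Qvol a \<beta> v x = (\<beta> * a\<^sup>2 / 2) ^ 3 *
     (\<Sum>b\<in>UNIV. \<Sum>c\<in>UNIV. \<Sum>d\<in>UNIV. levi_civita b c d
        * flux_avg x v 1 $ b * flux_avg x v 2 $ c * flux_avg x v 3 $ d)"

definition vol :: "real \<Rightarrow> real \<Rightarrow> 'l::nontriv vertex \<Rightarrow> 'l phase \<Rightarrow> real" where
  "vol a \<beta> v x = sqrt \<bar>Qvol a \<beta> v x\<bar>"

text \<open>The matrix \<open>{h(e)\<inverse>, V\<^sub>v}\<close>, taken entrywise.\<close>

definition hol_inv_bracket_vol ::
    "real \<Rightarrow> real \<Rightarrow> real \<Rightarrow> 'l::nontriv oriented_edge \<Rightarrow> 'l vertex \<Rightarrow> 'l phase \<Rightarrow> complex^2^2" where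
  "hol_inv_bracket_vol \<kappa> a \<beta> e v x =
     (\<chi> i j. poisson \<kappa> a (\<lambda>y. matrix_inv (hol y e) $ i $ j) (\<lambda>y. of_real (vol a \<beta> v y)) x)"

text \<open>
  \<open>C\<^bsub>\<mu>,v\<^esub>\<close> with the matrix \<open>\<tau>\<^sub>\<mu>\<close> as parameter \<open>M\<close>: \<open>M = mat 1\<close> for \<open>\<mu> = 0\<close> and \<open>M = tau j\<close> for
  \<open>\<mu> = j\<close>.  For \<open>h\<close> in \<open>SU(2)\<close> the trace is real.
\<close>

definition C_comp ::
    "real \<Rightarrow> real \<Rightarrow> real \<Rightarrow> complex^2^2 \<Rightarrow> 'l::nontriv vertex \<Rightarrow> 'l phase \<Rightarrow> real" where
  "C_comp \<kappa> a \<beta> M v x = - (8 / (3 * \<beta> * \<kappa>\<^sup>2)) *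
     (\<Sum>s\<^sub>1\<in>signs. \<Sum>s\<^sub>2\<in>signs. \<Sum>s\<^sub>3\<in>signs. \<Sum>I\<^sub>1\<in>UNIV. \<Sum>I\<^sub>2\<in>UNIV. \<Sum>I\<^sub>3\<in>UNIV.
        of_int (s\<^sub>1 * s\<^sub>2 * s\<^sub>3) * levi_civita I\<^sub>1 I\<^sub>2 I\<^sub>3 *
        Re (trace (M ** loop_hol x v I\<^sub>1 s\<^sub>1 I\<^sub>2 s\<^sub>2 ** hol x (edge_at v I\<^sub>3 s\<^sub>3)
              ** hol_inv_bracket_vol \<kappa> a \<beta> (edge_at v I\<^sub>3 s\<^sub>3) v x)))"

definition edge_length ::
    "real \<Rightarrow> real \<Rightarrow> 'l::nontriv vertex \<Rightarrow> 3 \<Rightarrow> int \<Rightarrow> 3 \<Rightarrow> int \<Rightarrow> 'l phase \<Rightarrow> real" where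
  "edge_length a \<beta> v I s\<^sub>1 J s\<^sub>2 x =
     1 / vol a \<beta> v x * norm (cross3 (flux x (edge_at v I s\<^sub>1)) (flux x (edge_at v J s\<^sub>2)))"

definition curvature :: "real \<Rightarrow> real \<Rightarrow> 'l::nontriv vertex \<Rightarrow> 'l phase \<Rightarrow> real" where
  "curvature a \<beta> v x =
     (\<Sum>I\<in>UNIV. \<Sum>J\<in>UNIV - {I}. \<Sum>s\<^sub>1\<in>signs. \<Sum>s\<^sub>2\<in>signs.
        edge_length a \<beta> v I s\<^sub>1 J s\<^sub>2 x *
        (2 * pi / 4 - pi +
         arccos ((flux x (edge_at v I s\<^sub>1) \<bullet> flux x (edge_at v J s\<^sub>2))
                 / (norm (flux x (edge_at v I s\<^sub>1)) * norm (flux x (edge_at v J s\<^sub>2))))))"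

text \<open>The Alesci-Assanioussi-Lewandowski-Makinen scalar constraint.\<close>

definition C_AALM :: "real \<Rightarrow> real \<Rightarrow> real \<Rightarrow> 'l::nontriv vertex \<Rightarrow> 'l phase \<Rightarrow> real" where
  "C_AALM \<kappa> a \<beta> v x =
     - (1 / \<beta>\<^sup>2) * C_comp \<kappa> a \<beta> (mat 1) v x - (1 + \<beta>\<^sup>2) / (\<kappa> * \<beta>\<^sup>2) * curvature a \<beta> v x"

definition H_dust :: "real \<Rightarrow> real \<Rightarrow> real \<Rightarrow> real \<Rightarrow> 'l::nontriv phase \<Rightarrow> real" where
  "H_dust \<kappa> a \<beta> \<alpha> x =
     (\<Sum>v\<in>UNIV. sqrt \<bar>(C_AALM \<kappa> a \<beta> v x)\<^sup>2 - \<alpha> / 4 * (\<Sum>j\<in>UNIV. (C_comp \<kappa> a \<beta> (tau j) v x)\<^sup>2)\<bar>)"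

definition H_scalar :: "real \<Rightarrow> real \<Rightarrow> real \<Rightarrow> 'l::nontriv phase \<Rightarrow> real" where
  "H_scalar \<kappa> a \<beta> x = (\<Sum>v\<in>UNIV. sqrt \<bar>vol a \<beta> v x * C_AALM \<kappa> a \<beta> v x\<bar>)"


section \<open>Perturbed homogeneous isotropic data\<close>

text \<open>
  The arguments \<open>dp_perp (v, I)\<close> and \<open>dth_perp (v, I)\<close> are meant to have vanishing \<open>I\<close>-component;
  accordingly only their components \<open>b \<noteq> I\<close> are varied in \<open>constraint_eqs\<close>.
\<close>

definition perturbed ::
    "real \<Rightarrow> real \<Rightarrow> ('l edge \<Rightarrow> real) \<Rightarrow> ('l edge \<Rightarrow> real^3)
      \<Rightarrow> ('l edge \<Rightarrow> real) \<Rightarrow> ('l edge \<Rightarrow> real^3) \<Rightarrow> 'l phase" where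
  "perturbed \<theta> p dp_par dp_perp dth_par dth_perp =
     (\<lambda>e. mexp ((1 / 2) *\<^sub>R su2_vec ((\<theta> + dth_par e) *\<^sub>R axis (snd e) 1 + dth_perp e)),
      \<lambda>e. (p + dp_par e) *\<^sub>R axis (snd e) 1 + dp_perp e)"

abbreviation no_pert :: "'l edge \<Rightarrow> 'b::zero" where "no_pert \<equiv> \<lambda>_. 0"

text \<open>\<open>has_partial_\<dots> H \<theta> p e \<dots> D\<close>: the partial derivative of \<open>H\<close> with respect to the named
  perturbation at \<open>e\<close> exists at \<open>\<delta>\<theta> = \<delta>p = 0\<close> and equals \<open>D\<close>.\<close>

definition has_partial_p_par ::
    "('l phase \<Rightarrow> real) \<Rightarrow> real \<Rightarrow> real \<Rightarrow> 'l edge \<Rightarrow> real \<Rightarrow> bool" where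
  "has_partial_p_par H \<theta> p e D \<longleftrightarrow>
     ((\<lambda>x. H (perturbed \<theta> p (no_pert(e := x)) no_pert no_pert no_pert))
        has_real_derivative D) (at 0)"

definition has_partial_theta_par ::
    "('l phase \<Rightarrow> real) \<Rightarrow> real \<Rightarrow> real \<Rightarrow> 'l edge \<Rightarrow> real \<Rightarrow> bool" where
  "has_partial_theta_par H \<theta> p e D \<longleftrightarrow>
     ((\<lambda>x. H (perturbed \<theta> p no_pert no_pert (no_pert(e := x)) no_pert))
        has_real_derivative D) (at 0)"

definition has_partial_p_perp ::
    "('l phase \<Rightarrow> real) \<Rightarrow> real \<Rightarrow> real \<Rightarrow> 'l edge \<Rightarrow> 3 \<Rightarrow> real \<Rightarrow> bool" where
  "has_partial_p_perp H \<theta> p e b D \<longleftrightarrow>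
     ((\<lambda>x. H (perturbed \<theta> p no_pert (no_pert(e := axis b x)) no_pert no_pert))
        has_real_derivative D) (at 0)"

definition has_partial_theta_perp ::
    "('l phase \<Rightarrow> real) \<Rightarrow> real \<Rightarrow> real \<Rightarrow> 'l edge \<Rightarrow> 3 \<Rightarrow> real \<Rightarrow> bool" where
  "has_partial_theta_perp H \<theta> p e b D \<longleftrightarrow>
     ((\<lambda>x. H (perturbed \<theta> p no_pert no_pert no_pert (no_pert(e := axis b x))))
        has_real_derivative D) (at 0)"

text \<open>The cosmological evolution equations at time \<open>t\<close> and the constraint equations at \<open>(\<theta>, p)\<close>; both
  include the existence of the partial derivatives involved.\<close>

definition evolution_eqs ::
    "real \<Rightarrow> real \<Rightarrow> ('l phase \<Rightarrow> real) \<Rightarrow> (real \<Rightarrow> real) \<Rightarrow> (real \<Rightarrow> real) \<Rightarrow> real \<Rightarrow> bool" where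
  "evolution_eqs \<kappa> a H \<theta> p t \<longleftrightarrow>
     (\<forall>v I. (\<exists>D. has_partial_p_par H (\<theta> t) (p t) (v, I) D \<and> deriv \<theta> t = - (\<kappa> / a\<^sup>2) * D) \<and>
            (\<exists>D. has_partial_theta_par H (\<theta> t) (p t) (v, I) D \<and> deriv p t = \<kappa> / a\<^sup>2 * D))"

definition constraint_eqs :: "('l phase \<Rightarrow> real) \<Rightarrow> real \<Rightarrow> real \<Rightarrow> bool" where
  "constraint_eqs H \<theta> p \<longleftrightarrow>
     (\<forall>v I b. b \<noteq> I \<longrightarrow> has_partial_p_perp H \<theta> p (v, I) b 0 \<and>
                        has_partial_theta_perp H \<theta> p (v, I) b 0)"

text \<open>Hamilton's equations \<open>\<theta>' = -\<partial>f/\<partial>p\<close>, \<open>p' = \<partial>f/\<partial>\<theta>\<close> at time \<open>t\<close> for a function \<open>f \<theta> p\<close>.\<close>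

definition reduced_eqs ::
    "(real \<Rightarrow> real \<Rightarrow> real) \<Rightarrow> (real \<Rightarrow> real) \<Rightarrow> (real \<Rightarrow> real) \<Rightarrow> real \<Rightarrow> bool" where
  "reduced_eqs f \<theta> p t \<longleftrightarrow>
     deriv \<theta> t = - deriv (\<lambda>q. f (\<theta> t) q) (p t) \<and>
     deriv p t = deriv (\<lambda>u. f u (p t)) (\<theta> t)"

end

theory Submission
  imports Defs
begin

text \<open>
  Every holonomy is a unit quaternion \<open>(q\<^sub>0, q)\<close>, acting as \<open>q\<^sub>0 + q\<^sup>a \<tau>\<^sub>a\<close>.  In this language
  \<open>h(e) {h(e)\<inverse>, V\<^sub>v}\<close> for the edge \<open>e\<^bsub>v;Is\<^esub>\<close> is \<open>s\<close> times a multiple of the cofactor vector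
  \<open>\<partial> det (X\<^sub>1, X\<^sub>2, X\<^sub>3) / \<partial> X\<^sub>I\<close>, for both signs \<open>s\<close>, so that \<open>C\<^bsub>\<mu>,v\<^esub>\<close> is an explicit
  function of holonomies and fluxes wherever \<open>Q\<^sub>v > 0\<close>.  At the homogeneous isotropic point the
  \<open>C\<^bsub>j,v\<^esub>\<close> vanish, and so do the curvature and its first variation, because the edges
  \<open>e\<^bsub>v;J+\<^esub>\<close> and \<open>e\<^bsub>v;J-\<^esub>\<close> contribute with opposite signs; hence the first variation of \<open>H\<close>
  comes from \<open>V\<^sub>v\<close> and \<open>C\<^bsub>0,v\<^esub>\<close> only.  Since all vertices have the same background values, only
  the sum over \<open>v\<close> of these variations matters, and a translation of the summation index makes it
  a function of the velocities summed over all edges of one direction.  The signed sum over the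
  loops picks out the odd parts \<open>b q b\<inverse> - b\<inverse> q b\<close> of conjugations, and what remains depends
  only on the velocity components parallel to the edges.
\<close>

text \<open>By continuity the sign of \<open>f\<close> is constant near \<open>x\<close>, so there
  the absolute value is multiplication by the fixed number \<open>\<sigma>\<close>. The rule serves
  the volume as well as both Hamiltonians.\<close>

lemma has_real_derivative_sqrt_abs [derivative_intros]:
  fixes f :: "real \<Rightarrow> real"
  assumes f: "(f has_real_derivative D) (at x)" and "f x \<noteq> 0"
  shows "((\<lambda>t. sqrt \<bar>f t\<bar>) has_real_derivative (sgn (f x) * D / (2 * sqrt \<bar>f x\<bar>))) (at x)"
proof -
  define \<sigma> where "\<sigma> = sgn (f x)"
  have pos: "\<sigma> * f x > 0" "\<bar>f x\<bar> = \<sigma> * f x"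
    using \<open>f x \<noteq> 0\<close> by (auto simp: \<sigma>_def sgn_if abs_if)
  have "isCont (\<lambda>t. \<sigma> * f t) x" by (intro continuous_intros DERIV_isCont [OF f])
  hence "(\<lambda>t. \<sigma> * f t) \<midarrow>x\<rightarrow> \<sigma> * f x" by (simp add: isCont_def)
  hence "eventually (\<lambda>t. \<sigma> * f t > 0) (at x)" using pos(1) by (rule order_tendstoD)
  hence "eventually (\<lambda>t. \<sigma> * f t > 0) (nhds x)" using pos(1) by (simp add: eventually_nhds_conv_at)
  hence "eventually (\<lambda>t. sqrt \<bar>f t\<bar> = sqrt (\<sigma> * f t)) (nhds x)"
    by eventually_elim (auto simp: \<sigma>_def sgn_if abs_if split: if_splits)
  moreover have "((\<lambda>t. sqrt (\<sigma> * f t)) has_real_derivative (\<sigma> * D / (2 * sqrt (\<sigma> * f x)))) (at x)"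
    using pos(1) by (auto intro!: derivative_eq_intros f simp: field_simps)
  ultimately show ?thesis
    unfolding pos(2) \<sigma>_def [symmetric] by (subst DERIV_cong_ev [OF refl _ refl])
qed

section \<open>Quaternions\<close>

type_synonym quat = "real \<times> (real^3)"

text \<open>Hamilton's product. The plus sign of the cross product matches
  \<open>tau 1 ** tau 2 = tau 3\<close>, so that \<open>qmat\<close> turns it into the matrix
  product.\<close>

definition qmul :: "quat \<Rightarrow> quat \<Rightarrow> quat" where
  "qmul q r = (fst q * fst r - snd q \<bullet> snd r,
               fst q *\<^sub>R snd r + fst r *\<^sub>R snd q + cross3 (snd q) (snd r))"

definition qcnj :: "quat \<Rightarrow> quat" where
  "qcnj q = (fst q, - snd q)"

definition qmat :: "quat \<Rightarrow> complex^2^2" where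
  "qmat q = fst q *\<^sub>R mat 1 + su2_vec (snd q)"

text \<open>Conjugation in the order \<open>k^-1 w k\<close>, as in the flux of a reversed edge; for
  unit \<open>k\<close> it is a rotation.\<close>

definition qrot :: "quat \<Rightarrow> real^3 \<Rightarrow> real^3" where
  "qrot k w = snd (qmul (qmul (qcnj k) (0, w)) k)"

lemma scaleR_axis: "x *\<^sub>R axis b y = axis b (x * y :: real)"
  by (simp add: vec_eq_iff axis_def)

lemma qmat_entries:
  "qmat q $ 1 $ 1 = Complex (fst q) (- (snd q $ 3))"
  "qmat q $ 1 $ 2 = Complex (- (snd q $ 2)) (- (snd q $ 1))"
  "qmat q $ 2 $ 1 = Complex (snd q $ 2) (- (snd q $ 1))"
  "qmat q $ 2 $ 2 = Complex (fst q) (snd q $ 3)"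
  by (simp_all add: qmat_def su2_vec_def tau_def pauli_def sum_3 mat_def vector_2 complex_eq_iff)

lemma qmat_qmul: "qmat q ** qmat r = qmat (qmul q r)"
  by (simp add: vec_eq_iff forall_2 matrix_matrix_mult_def sum_2 qmat_entries qmul_def
      inner_vec_def sum_3 cross3_simps complex_eq_iff)

lemma bounded_bilinear_qmul: "bounded_bilinear qmul"
  unfolding bilinear_conv_bounded_bilinear [symmetric]
  by (auto simp: bilinear_def linear_iff qmul_def inner_add_left inner_add_right
      cross_add_left cross_add_right cross_mult_left cross_mult_right algebra_simps)

lemma bounded_linear_qcnj: "bounded_linear qcnj"
  by (auto simp: linear_conv_bounded_linear [symmetric] linear_iff qcnj_def)

lemma linear_qmat: "linear qmat"
  by (auto simp: linear_iff qmat_def su2_vec_def scaleR_add_left scaleR_add_right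
      sum.distrib scaleR_sum_right)

lemma qmat_one: "qmat (1, 0) = mat 1"
  by (simp add: qmat_def su2_vec_def)

lemma qmat_tau: "qmat (0, axis j 1) = tau j"
  by (simp add: qmat_def su2_vec_def axis_def if_distrib [of "\<lambda>x. x *\<^sub>R _"] cong: if_cong)

lemma qmat_su2_vec: "qmat (0, w) = su2_vec w"
  by (simp add: qmat_def)

lemma qcnj_qcnj [simp]: "qcnj (qcnj q) = q"
  by (simp add: qcnj_def)

lemma norm_qcnj [simp]: "norm (qcnj q) = norm q"
  by (cases q) (simp add: qcnj_def norm_Pair)

lemma norm_quat: "(norm (q::quat))\<^sup>2 = (fst q)\<^sup>2 + snd q \<bullet> snd q"
  by (cases q) (simp add: norm_Pair power2_norm_eq_inner)

lemma qmul_qcnj: "norm q = 1 \<Longrightarrow> qmul q (qcnj q) = (1, 0)" "norm q = 1 \<Longrightarrow> qmul (qcnj q) q = (1, 0)"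
  using norm_quat [of q] by (auto simp: qmul_def qcnj_def power2_eq_square cross3_simps)

text \<open>After squaring this is Euler's four-square identity, a polynomial identity in the
  components.\<close>

lemma norm_qmul: "norm (qmul q r) = norm q * norm r"
proof -
  have "(norm (qmul q r))\<^sup>2 = (norm q * norm r)\<^sup>2"
    unfolding power_mult_distrib norm_quat
    by (simp add: qmul_def inner_vec_def sum_3 cross3_simps power2_eq_square)
  thus ?thesis by (simp add: power2_eq_iff_nonneg)
qed

lemma matrix_inv_unique:
  fixes A B :: "'a::semiring_1^'n^'n"
  assumes "A ** B = mat 1" "B ** A = mat 1"
  shows "matrix_inv A = B"
proof -
  have "A ** matrix_inv A = mat 1 \<and> matrix_inv A ** A = mat 1"
    unfolding matrix_inv_def by (rule someI [of _ B]) (simp add: assms)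
  hence "B = (matrix_inv A ** A) ** B" by simp
  also have "\<dots> = matrix_inv A ** (A ** B)" by (simp only: matrix_mul_assoc)
  finally show ?thesis using assms by simp
qed

lemma matrix_inv_qmat: "norm q = 1 \<Longrightarrow> matrix_inv (qmat q) = qmat (qcnj q)"
  by (rule matrix_inv_unique) (simp_all add: qmat_qmul qmul_qcnj qmat_one)

lemma Re_trace_qmat: "Re (trace (qmat q)) = 2 * fst q"
  by (simp add: trace_def sum_2 qmat_entries)

lemma fst_rot: "fst (qmul (qmul (qcnj k) (0, w)) k) = 0"
  by (simp add: qmul_def qcnj_def inner_vec_def sum_3 cross3_simps)

lemma rot_pair: "qmul (qmul (qcnj k) (0, w)) k = (0, qrot k w)"
  by (simp add: qrot_def fst_rot prod_eq_iff)

lemma qrot_adjoint: "n \<bullet> qrot k w = qrot (qcnj k) n \<bullet> w"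
  by (simp add: qrot_def qmul_def qcnj_def inner_vec_def sum_3 cross3_simps)

lemma qmul_assoc: "qmul (qmul p q) r = qmul p (qmul q r)"
  by (simp add: qmul_def prod_eq_iff vec_eq_iff forall_3 inner_vec_def sum_3 cross3_simps)

lemma qrot_cancel: "norm k = 1 \<Longrightarrow> qrot k (qrot (qcnj k) w) = w"
proof -
  assume k: "norm k = 1"
  have "(0, qrot k (qrot (qcnj k) w)) = qmul (qmul (qcnj k) (qmul (qmul (qcnj (qcnj k)) (0, w)) (qcnj k))) k"
    by (simp only: rot_pair)
  also have "\<dots> = qmul (qmul (qmul (qcnj k) k) (0, w)) (qmul (qcnj k) k)"
    by (simp add: qmul_assoc)
  also have "\<dots> = (0, w)"
    by (simp add: qmul_qcnj k) (simp add: qmul_def)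
  finally show ?thesis by simp
qed

lemma linear_qrot: "linear (qrot k)"
  by (auto simp: linear_iff qrot_def qmul_def inner_add_left inner_add_right
      cross_add_left cross_add_right cross_mult_left cross_mult_right algebra_simps)

text \<open>A rotated orthonormal basis is again orthonormal, and this is the expansion of
  \<open>n\<close> in it. The proof moves the rotation onto \<open>n\<close> by
  \<open>qrot_adjoint\<close>, uses the standard expansion there, and rotates back.\<close>

lemma qrot_frame: "norm k = 1 \<Longrightarrow> (\<Sum>b\<in>UNIV. (n \<bullet> qrot k (axis b 1)) *\<^sub>R qrot k (axis b 1)) = n"
proof -
  assume k: "norm k = 1"
  have "(\<Sum>b\<in>UNIV. (n \<bullet> qrot k (axis b 1)) *\<^sub>R qrot k (axis b 1))
     = (\<Sum>b\<in>UNIV. qrot k ((qrot (qcnj k) n $ b) *\<^sub>R axis b 1))"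
    by (simp add: qrot_adjoint inner_axis linear_cmul [OF linear_qrot])
  also have "\<dots> = qrot k (\<Sum>b\<in>UNIV. (qrot (qcnj k) n $ b) *\<^sub>R axis b 1)"
    by (simp add: linear_sum [OF linear_qrot])
  also have "(\<Sum>b\<in>UNIV. (qrot (qcnj k) n $ b) *\<^sub>R axis b 1) = qrot (qcnj k) n"
    by (simp add: vec_eq_iff axis_def if_distrib [of "\<lambda>x. _ * x"] cong: if_cong)
  finally show ?thesis by (simp add: qrot_cancel k)
qed

section \<open>The matrix exponential on su(2)\<close>

text \<open>The direction of \<open>w\<close> squares to -1, so with 1 it spans a copy of the
  complex plane, embedded by \<open>T\<close>. There multiplication by \<open>su2_vec w\<close> is
  multiplication by \<open>z = i |w|\<close>, and the complex exponential series carries over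
  through the bounded linear map \<open>T\<close>.\<close>

lemma mexp_su2_vec:
  "mexp (su2_vec w) = qmat (cos (norm w), (sin (norm w) / norm w) *\<^sub>R w)"
proof -
  define r where "r = norm w"
  define T where "T z = qmat (Re z, (Im z / r) *\<^sub>R w)" for z
  define z where "z = \<i> * of_real r"
  have "linear T"
    by (auto simp: linear_iff T_def qmat_def su2_vec_def scaleR_add_left scaleR_add_right
      sum.distrib scaleR_sum_right algebra_simps add_divide_distrib)
  hence T: "bounded_linear T" by (simp add: linear_conv_bounded_linear)
  \<comment> \<open>For nonzero \<open>w\<close> this rests on \<open>w w = - r^2\<close>; for
    \<open>w = 0\<close> both sides vanish, the quotient \<open>Im z / r\<close> being 0 by
    convention.\<close>
  have step: "su2_vec w ** T u = T (z * u)" for u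
  proof (cases "r = 0")
    case True
    thus ?thesis by (simp add: T_def z_def r_def qmat_def su2_vec_def)
  next
    case False
    have "w \<bullet> w = r * r" by (simp add: r_def dot_square_norm power2_eq_square)
    thus ?thesis using False
      by (simp add: T_def z_def qmat_su2_vec [symmetric] qmat_qmul qmul_def cross_mult_right mult.commute)
  qed
  have "((**) (su2_vec w) ^^ n) (mat 1) = T (z ^ n)" for n
    by (induction n) (simp_all add: step, simp add: T_def qmat_one)
  hence "(1 / fact n) *\<^sub>R (((**) (su2_vec w)) ^^ n) (mat 1) = T (z ^ n /\<^sub>R fact n)" for n
    by (simp add: linear_cmul [OF \<open>linear T\<close>] inverse_eq_divide)
  moreover have "(\<lambda>n. T (z ^ n /\<^sub>R fact n)) sums T (exp z)"
    by (rule bounded_linear.sums [OF T exp_converges])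
  ultimately have "mexp (su2_vec w) = T (exp z)"
    unfolding mexp_def by (simp add: sums_iff)
  thus ?thesis by (simp add: T_def z_def r_def Re_exp Im_exp)
qed

lemma su2_vec_axis: "su2_vec (x *\<^sub>R axis b 1) = x *\<^sub>R tau b"
  by (simp add: su2_vec_def axis_def if_distrib [of "\<lambda>x. x *\<^sub>R _"] if_distrib [of "\<lambda>y. x * y"] cong: if_cong)

lemma su2_vec_scaleR: "su2_vec (x *\<^sub>R w) = x *\<^sub>R su2_vec w"
  by (simp add: su2_vec_def scaleR_sum_right)

lemma mexp_axis: "mexp (su2_vec (x *\<^sub>R axis b 1)) = qmat (cos x, sin x *\<^sub>R axis b 1)"
  by (simp add: mexp_su2_vec abs_real_def)

lemma mexp_tau: "mexp (x *\<^sub>R tau b) = qmat (cos x, sin x *\<^sub>R axis b 1)"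
  using mexp_axis by (simp add: su2_vec_axis)

section \<open>Phase space points with unit quaternions\<close>

definition phase_of :: "('l edge \<Rightarrow> quat) \<Rightarrow> ('l edge \<Rightarrow> real^3) \<Rightarrow> 'l phase" where
  "phase_of k P = (\<lambda>e. qmat (k e), P)"

fun holq :: "('l edge \<Rightarrow> quat) \<Rightarrow> 'l oriented_edge \<Rightarrow> quat" where
  "holq k (Fwd e) = k e"
| "holq k (Rev e) = qcnj (k e)"

text \<open>The minus sign for \<open>Rev\<close> arises because \<open>tau a ** tau b\<close> has
  trace -2 for \<open>a = b\<close> and 0 otherwise, so half the trace in \<open>flux\<close>
  returns minus the rotated component.\<close>

fun fluxq :: "('l edge \<Rightarrow> quat) \<Rightarrow> ('l edge \<Rightarrow> real^3) \<Rightarrow> 'l oriented_edge \<Rightarrow> real^3" where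
  "fluxq k P (Fwd e) = P e"
| "fluxq k P (Rev e) = - qrot (k e) (P e)"

fun base_edge :: "'l oriented_edge \<Rightarrow> 'l edge" where
  "base_edge (Fwd e) = e"
| "base_edge (Rev e) = e"

definition loopq :: "('l::nontriv edge \<Rightarrow> quat) \<Rightarrow> 'l vertex \<Rightarrow> 3 \<Rightarrow> int \<Rightarrow> 3 \<Rightarrow> int \<Rightarrow> quat" where
  "loopq k v I s J s' =
     qmul (qmul (qmul (holq k (edge_at v I s)) (holq k (edge_at (shift v I s) J s')))
       (qcnj (holq k (edge_at (shift v J s') I s)))) (qcnj (holq k (edge_at v J s')))"

definition avgq :: "('l::nontriv edge \<Rightarrow> quat) \<Rightarrow> ('l edge \<Rightarrow> real^3) \<Rightarrow> 'l vertex \<Rightarrow> 3 \<Rightarrow> real^3" where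
  "avgq k P v I = (1 / 2) *\<^sub>R (fluxq k P (edge_at v I 1) - fluxq k P (edge_at v I (-1)))"

text \<open>The cofactors: \<open>cofac X I\<close> is the gradient of \<open>det (X\<^sub>1, X\<^sub>2, X\<^sub>3)\<close> in \<open>X\<^sub>I\<close>.\<close>

definition cofac :: "(3 \<Rightarrow> real^3) \<Rightarrow> 3 \<Rightarrow> real^3" where
  "cofac X I = (if I = 1 then cross3 (X 2) (X 3) else if I = 2 then cross3 (X 3) (X 1)
                else cross3 (X 1) (X 2))"

definition triple :: "(3 \<Rightarrow> real^3) \<Rightarrow> real" where
  "triple X = X 1 \<bullet> cross3 (X 2) (X 3)"

lemma norm_holq: "(\<And>e. norm (k e) = 1) \<Longrightarrow> norm (holq k oe) = 1"
  by (cases oe) simp_all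

lemma hol_phase_of: "(\<And>e. norm (k e) = 1) \<Longrightarrow> hol (phase_of k P) oe = qmat (holq k oe)"
  by (cases oe) (simp_all add: phase_of_def matrix_inv_qmat)

lemma flux_phase_of:
  assumes "\<And>e. norm (k e) = 1"
  shows "flux (phase_of k P) oe = fluxq k P oe"
proof (cases oe)
  case (Rev e)
  have "Re (trace (tau a ** matrix_inv (qmat (k e)) ** su2_vec (P e) ** qmat (k e))) / 2
      = fst (qmul (0, axis a 1) (qmul (qmul (qcnj (k e)) (0, P e)) (k e)))" for a
    by (simp add: matrix_inv_qmat assms qmat_tau [symmetric] qmat_su2_vec [symmetric] qmat_qmul
        Re_trace_qmat qmul_assoc)
  also have "\<dots> a = - qrot (k e) (P e) $ a" for a
    by (simp only: rot_pair) (simp add: qmul_def inner_axis')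
  finally show ?thesis
    by (simp add: Rev phase_of_def vec_eq_iff)
qed (simp add: phase_of_def)

lemma flux_avg_phase_of:
  "(\<And>e. norm (k e) = 1) \<Longrightarrow> flux_avg (phase_of k P) v = avgq k P v"
  by (rule ext) (simp add: flux_avg_def avgq_def flux_phase_of)

lemma loop_hol_phase_of:
  assumes "\<And>e. norm (k e) = 1"
  shows "loop_hol (phase_of k P) v I s J s' = qmat (loopq k v I s J s')"
  by (simp add: loop_hol_def loopq_def hol_phase_of assms matrix_inv_qmat norm_holq qmat_qmul)

lemma levi_civita_triple:
  "(\<Sum>b\<in>UNIV. \<Sum>c\<in>UNIV. \<Sum>d\<in>UNIV. levi_civita b c d * X $ b * Y $ c * Z $ d) = X \<bullet> cross3 Y Z"
  by (simp add: sum_3 levi_civita_def cross3_simps)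

lemma Qvol_phase_of:
  assumes "\<And>e. norm (k e) = 1"
  shows "Qvol a \<beta> v (phase_of k P) = (\<beta> * a\<^sup>2 / 2) ^ 3 * triple (avgq k P v)"
  by (simp add: Qvol_def flux_avg_phase_of assms levi_civita_triple triple_def)

text \<open>The determinant is linear in each slot, so the change is exact and not only of first
  order.\<close>

lemma triple_update: "triple (X(I := X I + w)) = triple X + cofac X I \<bullet> w"
  using exhaust_3 [of I]
  by (auto simp: triple_def cofac_def cross3_simps)

text \<open>Since 1 and 0 differ modulo L, the forward and the backward edge at \<open>v\<close> in
  direction \<open>I\<close> lie over different base edges; varying the flux of one leaves that of
  the other fixed.\<close>

lemma shift_neq: "shift v I (-1) \<noteq> (v :: 'l::nontriv vertex)"
proof
  assume "shift v I (-1) = v"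
  hence "axis I (-1) = (0 :: 'l vertex)" by (simp add: shift_def)
  hence "(axis I (-1) :: 'l vertex) $ I = 0" by simp
  thus False by simp
qed

lemma qrot_add: "qrot k (x + y) = qrot k x + qrot k y"
  using linear_qrot by (simp add: linear_iff)

text \<open>Among the averages at \<open>v\<close> only the one in direction \<open>I\<close> sees
  this edge. For \<open>s = -1\<close> the minus sign of the average and that of the reversed flux
  are kept apart, which lets both signs share one formula.\<close>

lemma avgq_update:
  fixes v :: "'l::nontriv vertex"
  assumes s: "s \<in> signs"
  shows "avgq k (P(base_edge (edge_at v I s) := P (base_edge (edge_at v I s)) + w)) v
    = (avgq k P v)(I := avgq k P v I + (of_int s / 2) *\<^sub>R
        (if s = 1 then w else - qrot (k (base_edge (edge_at v I s))) w))"
  using s shift_neq [of v] shift_neq [of v, symmetric]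
  by (auto simp: avgq_def edge_at_def fun_eq_iff qrot_add algebra_simps)

section \<open>The bracket of a holonomy with the volume\<close>

lemma hol_cong_fst: "fst x = fst y \<Longrightarrow> hol x oe = hol y oe"
  by (cases oe) simp_all

lemma has_vector_derivative_mexp_tau:
  "((\<lambda>t. (cos (t / 2), sin (t / 2) *\<^sub>R axis b 1) :: quat) has_vector_derivative (0, axis b (1 / 2))) (at 0)"
proof -
  have "((\<lambda>t. (cos (t / 2), sin (t / 2) *\<^sub>R axis b 1) :: quat) has_vector_derivative (0, (1 / 2) *\<^sub>R axis b 1)) (at 0)"
    by (intro has_vector_derivative_Pair)
       (auto intro!: derivative_eq_intros simp: has_real_derivative_iff_has_vector_derivative [symmetric])
  thus ?thesis by (simp add: scaleR_axis)
qed

lemma deriv_hol_matrix_inv: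
  fixes v :: "'l::nontriv vertex"
  assumes k: "\<And>e. norm (k e) = 1" 
  shows "deriv_hol (\<lambda>y. matrix_inv (hol y oe) $ i $ j) e b (phase_of k P) =
    (if e = base_edge oe
     then qmat ((case oe of Fwd _ \<Rightarrow> qcnj | Rev _ \<Rightarrow> id) (qmul (0, axis b (1 / 2)) (k e))) $ i $ j
     else 0)"
proof (cases "e = base_edge oe")
  case False
  have "hol (((fst (phase_of k P))(e := M), Q)) oe = hol (phase_of k P) oe" for M Q
    using False by (cases oe) auto
  thus ?thesis using False by (simp add: deriv_hol_def)
next
  case True
  \<comment> \<open>Inverting a forward holonomy conjugates the quaternion, inverting a reversed one
    gives back the quaternion itself. Both maps are linear, so the velocity passes through
    them.\<close>
  define S where "S = (case oe of Fwd _ \<Rightarrow> qcnj | Rev _ \<Rightarrow> id)"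
  have [simp]: "norm (cos t, sin t *\<^sub>R axis b 1 :: real^3) = 1" for t
    by (simp add: norm_Pair)
  have "matrix_inv (hol ((fst (phase_of k P))(e := mexp ((t / 2) *\<^sub>R tau b) ** fst (phase_of k P) e), snd (phase_of k P)) oe)
     = qmat (S (qmul (cos (t / 2), sin (t / 2) *\<^sub>R axis b 1) (k e)))" for t
    using True
    by (cases oe) (simp_all add: S_def phase_of_def mexp_tau qmat_qmul matrix_inv_qmat norm_qmul k)
  moreover have "bounded_linear (\<lambda>q. qmat (S (qmul q (k e))) $ i $ j)"
  proof -
    have "bounded_linear S" by (cases oe) (auto simp: S_def bounded_linear_qcnj id_def)
    hence "bounded_linear (\<lambda>q. qmat (S (qmul q (k e))))"
      using bounded_linear_compose [OF linear_qmat [unfolded linear_conv_bounded_linear]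
          bounded_linear_compose [OF _ bounded_bilinear.bounded_linear_left [OF bounded_bilinear_qmul]]]
      by blast
    thus ?thesis
      by (intro bounded_linear_compose [OF bounded_linear_vec_nth] )
  qed
  ultimately show ?thesis
    using bounded_linear.has_vector_derivative [OF _ has_vector_derivative_mexp_tau, of "\<lambda>q. qmat (S (qmul q (k e))) $ i $ j" b] True
    by (simp add: deriv_hol_def S_def vector_derivative_at)
qed

text \<open>Along a single flux component \<open>Qvol\<close> is affine. The factor 1/4 collects one
  half from the average over the two orientations and one half from the square root.\<close>

lemma deriv_flux_vol:
  fixes v :: "'l::nontriv vertex" and I :: 3
  assumes k: "\<And>e. norm (k e) = 1" and s: "s \<in> signs" and Q: "Qvol a \<beta> v (phase_of k P) > 0"
  defines "e \<equiv> base_edge (edge_at v I s)"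
  shows "deriv_flux (\<lambda>y. of_real (vol a \<beta> v y)) e b (phase_of k P) =
    of_real (s * (\<beta> * a\<^sup>2 / 2) ^ 3 / (4 * vol a \<beta> v (phase_of k P)) * (cofac (avgq k P v) I \<bullet>
      (if s = 1 then axis b 1 else - qrot (k e) (axis b 1))))"
proof -
  define r where "r = (if s = 1 then axis b 1 else - qrot (k e) (axis b 1))"
  define c where "c = (\<beta> * a\<^sup>2 / 2) ^ 3"
  define Q0 where "Q0 = Qvol a \<beta> v (phase_of k P)"
  define d where "d = cofac (avgq k P v) I \<bullet> r"
  have ax: "axis b t = t *\<^sub>R axis b (1::real)" for t by (simp add: scaleR_axis)
  have rt: "(if s = 1 then axis b t else - qrot (k e) (axis b t)) = t *\<^sub>R r" for t
    unfolding r_def ax [of t] by (simp add: linear_cmul [OF linear_qrot])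
  have "Qvol a \<beta> v (fst (phase_of k P), (snd (phase_of k P))(e := snd (phase_of k P) e + axis b t))
     = Qvol a \<beta> v (phase_of k (P(e := P e + axis b t)))" for t
    by (simp add: phase_of_def)
  also have "\<dots> t = Q0 + c * (s / 2 * t * d)" for t
    unfolding Q0_def Qvol_phase_of [OF k] e_def avgq_update [OF s] triple_update
    unfolding e_def [symmetric] rt c_def [symmetric] d_def by (simp add: algebra_simps)
  finally have 1: "vol a \<beta> v (fst (phase_of k P), (snd (phase_of k P))(e := snd (phase_of k P) e + axis b t))
     = sqrt \<bar>Q0 + c * (s / 2 * t * d)\<bar>" for t
    by (simp add: vol_def)
  have "Q0 > 0" using Q by (simp add: Q0_def)
  hence "((\<lambda>t. sqrt \<bar>Q0 + c * (s / 2 * t * d)\<bar>) has_real_derivative (s * c / (4 * sqrt Q0) * d)) (at 0)"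
    by (auto intro!: derivative_eq_intros has_real_derivative_sqrt_abs)
  hence "((\<lambda>t. complex_of_real (sqrt \<bar>Q0 + c * (s / 2 * t * d)\<bar>)) has_vector_derivative of_real (s * c / (4 * sqrt Q0) * d)) (at 0)"
    by (intro bounded_linear.has_vector_derivative [OF bounded_linear_of_real])
       (simp add: has_real_derivative_iff_has_vector_derivative)
  moreover have "vol a \<beta> v (phase_of k P) = sqrt Q0"
    using \<open>Q0 > 0\<close> by (simp add: vol_def Q0_def)
  ultimately show ?thesis
    unfolding deriv_flux_def 1 d_def r_def c_def by (simp add: vector_derivative_at)
qed

text \<open>The same vector \<open>r b\<close> occurs twice: in the derivative of the volume through
  \<open>n \<bullet> r b\<close>, and in \<open>h\<close> times the derivative of its inverse as
  \<open>- r b / 2\<close>. Summing over \<open>b\<close> expands \<open>n\<close> in an orthonormal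
  frame, so the rotation attached to a backward edge disappears.\<close>

lemma hol_bracket_vol:
  fixes v :: "'l::nontriv vertex"
  assumes k: "\<And>e. norm (k e) = 1" and s: "s \<in> signs" and Q: "Qvol a \<beta> v (phase_of k P) > 0"
  shows "hol (phase_of k P) (edge_at v I s) **
      hol_inv_bracket_vol \<kappa> a \<beta> (edge_at v I s) v (phase_of k P) =
    qmat (0, (s * \<kappa> * (\<beta> * a\<^sup>2 / 2) ^ 3 / (8 * a\<^sup>2 * vol a \<beta> v (phase_of k P))) *\<^sub>R cofac (avgq k P v) I)"
proof -
  define oe where "oe = edge_at v I s"
  define e where "e = base_edge oe"
  define x where "x = phase_of k P"
  define S where "S = (case oe of Fwd _ \<Rightarrow> qcnj | Rev _ \<Rightarrow> id)"
  define r where "r b = (if s = 1 then axis b 1 else - qrot (k e) (axis b 1))" for b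
  define D where "D b = S (qmul (0, axis b (1 / 2)) (k e))" for b
  define n where "n = cofac (avgq k P v) I"
  define A where "A = s * (\<beta> * a\<^sup>2 / 2) ^ 3 / (4 * vol a \<beta> v x)"
  \<comment> \<open>Holonomies do not depend on fluxes. This removes the first mixed term and the
    flux-flux term of \<open>poisson\<close>, so the dependence of the volume on holonomies, through
    reversed edges, does not enter.\<close>
  have df: "deriv_flux (\<lambda>y. matrix_inv (hol y oe) $ i $ j) e' b x = 0" for e' b i j
    unfolding deriv_flux_def
    by (subst hol_cong_fst [of _ x]) simp_all
  have dh: "deriv_hol (\<lambda>y. matrix_inv (hol y oe) $ i $ j) e' b x
     = (if e' = e then qmat (D b) $ i $ j else 0)" for e' b i j
    unfolding x_def deriv_hol_matrix_inv [OF k] by (simp add: D_def e_def S_def)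
  have dv: "deriv_flux (\<lambda>y. of_real (vol a \<beta> v y)) e b x = of_real (A * (n \<bullet> r b))" for b
    unfolding x_def e_def oe_def deriv_flux_vol [OF k s Q]
    by (simp add: A_def n_def r_def x_def e_def oe_def)
  have "hol_inv_bracket_vol \<kappa> a \<beta> oe v x = (\<chi> i j. of_real (\<kappa> / a\<^sup>2) *
     (\<Sum>e'\<in>UNIV. \<Sum>b\<in>UNIV. if e' = e then - (qmat (D b) $ i $ j * of_real (A * (n \<bullet> r b))) else 0))"
    unfolding hol_inv_bracket_vol_def poisson_def df dh
    by (simp add: if_distrib [of "\<lambda>x. x * _"] if_distrib [of "\<lambda>x. - x"] dv cong: if_cong)
  also have "\<dots> = (\<chi> i j. of_real (\<kappa> / a\<^sup>2) *
     (\<Sum>b\<in>UNIV. - (qmat (D b) $ i $ j * of_real (A * (n \<bullet> r b)))))"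
    by (subst sum.swap) simp
  also have "\<dots> = qmat (\<Sum>b\<in>UNIV. (- \<kappa> / a\<^sup>2 * (A * (n \<bullet> r b))) *\<^sub>R D b)"
    unfolding linear_sum [OF linear_qmat] linear_cmul [OF linear_qmat]
    by (simp add: vec_eq_iff sum_distrib_left) (simp add: scaleR_conv_of_real mult_ac)
  finally have br: "hol_inv_bracket_vol \<kappa> a \<beta> oe v x =
     qmat (\<Sum>b\<in>UNIV. (- \<kappa> / a\<^sup>2 * (A * (n \<bullet> r b))) *\<^sub>R D b)" .
  \<comment> \<open>Forward edge: the velocity of the inverse is \<open>h^-1\<close> times
    \<open>- tau b / 2\<close>, and \<open>h\<close> cancels. Backward edge: the product is a
    conjugation by \<open>k e\<close>, which is the rotation in \<open>r b\<close>.\<close>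
  have hD: "qmul (holq k oe) (D b) = (0, (- 1 / 2) *\<^sub>R r b)" for b
  proof (cases "s = 1")
    case True
    have "qmul (k e) (qcnj (qmul (0, axis b (1 / 2)) (k e))) = qmul (qmul (k e) (qcnj (k e))) (0, - axis b (1/2))"
      by (simp add: qmul_def qcnj_def prod_eq_iff vec_eq_iff forall_3 inner_vec_def sum_3 cross3_simps)
    also have "\<dots> = (0, - axis b (1/2))" by (simp add: qmul_qcnj k) (simp add: qmul_def)
    finally show ?thesis using True
      by (simp add: D_def S_def oe_def e_def edge_at_def r_def vec_eq_iff axis_def)
  next
    case False
    have "qmul (qcnj (k e)) (qmul (0, axis b (1 / 2)) (k e)) = (0, qrot (k e) (axis b (1 / 2)))"
      by (simp add: rot_pair [symmetric] qmul_assoc)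
    also have "qrot (k e) (axis b (1 / 2)) = (1 / 2) *\<^sub>R qrot (k e) (axis b 1)"
      using linear_cmul [OF linear_qrot, of "k e" "1 / 2" "axis b 1"] by (simp add: scaleR_axis)
    finally show ?thesis using False
      by (simp add: D_def S_def oe_def e_def edge_at_def r_def)
  qed
  have frame: "(\<Sum>b\<in>UNIV. (n \<bullet> r b) *\<^sub>R r b) = n"
  proof (cases "s = 1")
    case True
    thus ?thesis
      by (simp add: r_def inner_axis)
         (simp add: vec_eq_iff axis_def if_distrib [of "\<lambda>x. _ * x"] cong: if_cong)
  qed (simp add: r_def qrot_frame k)
  have "qmul (holq k oe) (\<Sum>b\<in>UNIV. (- \<kappa> / a\<^sup>2 * (A * (n \<bullet> r b))) *\<^sub>R D b) =
     (\<Sum>b\<in>UNIV. (- \<kappa> / a\<^sup>2 * (A * (n \<bullet> r b))) *\<^sub>R (0, (- 1 / 2) *\<^sub>R r b))"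
    by (simp only: bounded_bilinear.sum_right [OF bounded_bilinear_qmul]
        bounded_bilinear.scaleR_right [OF bounded_bilinear_qmul] hD)
  also have "\<dots> = (\<Sum>b\<in>UNIV. (\<kappa> * A / (2 * a\<^sup>2)) *\<^sub>R (0, (n \<bullet> r b) *\<^sub>R r b))"
    by (intro sum.cong) (simp_all add: field_simps)
  also have "\<dots> = (0, (\<kappa> * A / (2 * a\<^sup>2)) *\<^sub>R n)"
    by (subst frame [symmetric])
       (simp add: prod_eq_iff fst_sum snd_sum scaleR_sum_right)
  finally have product: "qmul (holq k oe) (\<Sum>b\<in>UNIV. (- \<kappa> / a\<^sup>2 * (A * (n \<bullet> r b))) *\<^sub>R D b)
     = (0, (\<kappa> * A / (2 * a\<^sup>2)) *\<^sub>R n)" .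
  have "hol x oe = qmat (holq k oe)"
    by (simp add: x_def hol_phase_of k)
  thus ?thesis
    unfolding oe_def [symmetric] x_def [symmetric] br by (simp only: qmat_qmul product)
       (simp add: A_def n_def mult_ac)
qed

text \<open>The sign \<open>s\<^sub>3\<close> cancels against the sign of the bracket.\<close>

lemma C_comp_phase_of:
  fixes v :: "'l::nontriv vertex"
  assumes k: "\<And>e. norm (k e) = 1" and Q: "Qvol a \<beta> v (phase_of k P) > 0" 
  shows "C_comp \<kappa> a \<beta> (qmat m) v (phase_of k P) =
    - (4 * (\<beta> * a\<^sup>2 / 2) ^ 3 / (3 * \<beta> * \<kappa> * a\<^sup>2)) / vol a \<beta> v (phase_of k P) *
     (\<Sum>s\<^sub>1\<in>signs. \<Sum>s\<^sub>2\<in>signs. \<Sum>I\<^sub>1\<in>UNIV. \<Sum>I\<^sub>2\<in>UNIV. \<Sum>I\<^sub>3\<in>UNIV.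
        of_int (s\<^sub>1 * s\<^sub>2) * levi_civita I\<^sub>1 I\<^sub>2 I\<^sub>3 *
        fst (qmul (qmul m (loopq k v I\<^sub>1 s\<^sub>1 I\<^sub>2 s\<^sub>2)) (0, cofac (avgq k P v) I\<^sub>3)))"
proof -
  define V where "V = vol a \<beta> v (phase_of k P)"
  define c where "c = (\<beta> * a\<^sup>2 / 2) ^ 3"
  define F where "F s\<^sub>1 s\<^sub>2 I\<^sub>1 I\<^sub>2 I\<^sub>3 =
    fst (qmul (qmul m (loopq k v I\<^sub>1 s\<^sub>1 I\<^sub>2 s\<^sub>2)) (0, cofac (avgq k P v) I\<^sub>3))" for s\<^sub>1 s\<^sub>2 I\<^sub>1 I\<^sub>2 I\<^sub>3
  have tr: "Re (trace (qmat m ** loop_hol (phase_of k P) v I\<^sub>1 s\<^sub>1 I\<^sub>2 s\<^sub>2 ** hol (phase_of k P) (edge_at v I\<^sub>3 s\<^sub>3)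
       ** hol_inv_bracket_vol \<kappa> a \<beta> (edge_at v I\<^sub>3 s\<^sub>3) v (phase_of k P)))
     = s\<^sub>3 * (\<kappa> * c / (4 * a\<^sup>2 * V)) * F s\<^sub>1 s\<^sub>2 I\<^sub>1 I\<^sub>2 I\<^sub>3" if "s\<^sub>3 \<in> signs" for s\<^sub>1 s\<^sub>2 s\<^sub>3 I\<^sub>1 I\<^sub>2 I\<^sub>3
  proof -
    have z: "(0, u *\<^sub>R w) = u *\<^sub>R (0::real, w)" for u and w :: "real^3" by simp
    show ?thesis
      unfolding matrix_mul_assoc [symmetric, of _ "hol _ _"] hol_bracket_vol [OF k that Q]
        loop_hol_phase_of [OF k] matrix_mul_assoc
      unfolding qmat_qmul Re_trace_qmat z bounded_bilinear.scaleR_right [OF bounded_bilinear_qmul]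
      by (simp add: F_def c_def V_def mult_ac)
  qed
  have two: "(\<Sum>s\<^sub>3\<in>signs. u) = 2 * u" for u :: real by simp
  have cancel: "of_int (s\<^sub>1 * s\<^sub>2 * s\<^sub>3) * E * (s\<^sub>3 * K * G) = K * (of_int (s\<^sub>1 * s\<^sub>2) * E * G)"
    if "s\<^sub>3 \<in> signs" for s\<^sub>1 s\<^sub>2 s\<^sub>3 :: int and E G K :: real
    using that by auto
  have "C_comp \<kappa> a \<beta> (qmat m) v (phase_of k P) = - (8 / (3 * \<beta> * \<kappa>\<^sup>2)) *
     (\<Sum>s\<^sub>1\<in>signs. \<Sum>s\<^sub>2\<in>signs. \<Sum>s\<^sub>3\<in>signs. \<Sum>I\<^sub>1\<in>UNIV. \<Sum>I\<^sub>2\<in>UNIV. \<Sum>I\<^sub>3\<in>UNIV.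
        of_int (s\<^sub>1 * s\<^sub>2 * s\<^sub>3) * levi_civita I\<^sub>1 I\<^sub>2 I\<^sub>3 * (s\<^sub>3 * (\<kappa> * c / (4 * a\<^sup>2 * V)) * F s\<^sub>1 s\<^sub>2 I\<^sub>1 I\<^sub>2 I\<^sub>3))"
    unfolding C_comp_def by (intro arg_cong2 [of _ _ _ _ "(*)"] sum.cong refl) (simp only: tr)
  also have "\<dots> = - (8 / (3 * \<beta> * \<kappa>\<^sup>2)) *
     (\<Sum>s\<^sub>1\<in>signs. \<Sum>s\<^sub>2\<in>signs. \<Sum>s\<^sub>3\<in>signs. \<Sum>I\<^sub>1\<in>UNIV. \<Sum>I\<^sub>2\<in>UNIV. \<Sum>I\<^sub>3\<in>UNIV.
        (\<kappa> * c / (4 * a\<^sup>2 * V)) * (of_int (s\<^sub>1 * s\<^sub>2) * levi_civita I\<^sub>1 I\<^sub>2 I\<^sub>3 * F s\<^sub>1 s\<^sub>2 I\<^sub>1 I\<^sub>2 I\<^sub>3))"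
    by (rule arg_cong [of _ _ "(*) _"], intro sum.cong refl, rule cancel)
  also have "\<dots> = - (8 / (3 * \<beta> * \<kappa>\<^sup>2)) * (2 * ((\<kappa> * c / (4 * a\<^sup>2 * V)) *
     (\<Sum>s\<^sub>1\<in>signs. \<Sum>s\<^sub>2\<in>signs. \<Sum>I\<^sub>1\<in>UNIV. \<Sum>I\<^sub>2\<in>UNIV. \<Sum>I\<^sub>3\<in>UNIV.
        (of_int (s\<^sub>1 * s\<^sub>2) * levi_civita I\<^sub>1 I\<^sub>2 I\<^sub>3 * F s\<^sub>1 s\<^sub>2 I\<^sub>1 I\<^sub>2 I\<^sub>3))))"
    by (simp only: sum_distrib_left [symmetric] two)
  also have "- (8 / (3 * \<beta> * \<kappa>\<^sup>2)) * (2 * ((\<kappa> * c / (4 * a\<^sup>2 * V)) * Y)) = - (4 * c / (3 * \<beta> * \<kappa> * a\<^sup>2)) / V * Y" for Y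
    by (simp add: power2_eq_square mult_ac)
  finally show ?thesis unfolding F_def V_def c_def .
qed

section \<open>First variation around homogeneous isotropic data\<close>

interpretation qmul: bounded_bilinear qmul
  by (rule bounded_bilinear_qmul)

interpretation cross3: bounded_bilinear cross3
  using bilinear_cross by (simp add: bilinear_conv_bounded_bilinear)

definition loop_sum :: "('l::nontriv edge \<Rightarrow> quat) \<Rightarrow> 'l vertex \<Rightarrow> 3 \<Rightarrow> 3 \<Rightarrow> quat" where
  "loop_sum k v I J = (\<Sum>s\<^sub>1\<in>signs. \<Sum>s\<^sub>2\<in>signs. of_int (s\<^sub>1 * s\<^sub>2) *\<^sub>R loopq k v I s\<^sub>1 J s\<^sub>2)"

text \<open>Bilinear in the loops \<open>L\<close> and the vectors \<open>w\<close>, so its first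
  variation is obtained by replacing one of the two arguments by its variation.\<close>

definition C_poly :: "quat \<Rightarrow> (3 \<Rightarrow> 3 \<Rightarrow> quat) \<Rightarrow> (3 \<Rightarrow> real^3) \<Rightarrow> real" where
  "C_poly m L w = (\<Sum>I\<^sub>1\<in>UNIV. \<Sum>I\<^sub>2\<in>UNIV. \<Sum>I\<^sub>3\<in>UNIV.
     levi_civita I\<^sub>1 I\<^sub>2 I\<^sub>3 * fst (qmul (qmul m (L I\<^sub>1 I\<^sub>2)) (0, w I\<^sub>3)))"

lemma C_comp_C_poly:
  assumes "\<And>e. norm (k e) = 1" and "Qvol a \<beta> v (phase_of k P) > 0" 
  shows "C_comp \<kappa> a \<beta> (qmat m) v (phase_of k P) =
    - (4 * (\<beta> * a\<^sup>2 / 2) ^ 3 / (3 * \<beta> * \<kappa> * a\<^sup>2)) / vol a \<beta> v (phase_of k P) *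
     C_poly m (loop_sum k v) (cofac (avgq k P v))"
proof -
  define F where "F s\<^sub>1 s\<^sub>2 I\<^sub>1 I\<^sub>2 I\<^sub>3 =
    fst (qmul (qmul m (loopq k v I\<^sub>1 s\<^sub>1 I\<^sub>2 s\<^sub>2)) (0, cofac (avgq k P v) I\<^sub>3))" for s\<^sub>1 s\<^sub>2 I\<^sub>1 I\<^sub>2 I\<^sub>3
  have expand: "fst (qmul (qmul m (loop_sum k v I\<^sub>1 I\<^sub>2)) (0, cofac (avgq k P v) I\<^sub>3))
     = F 1 1 I\<^sub>1 I\<^sub>2 I\<^sub>3 - F 1 (-1) I\<^sub>1 I\<^sub>2 I\<^sub>3 - F (-1) 1 I\<^sub>1 I\<^sub>2 I\<^sub>3 + F (-1) (-1) I\<^sub>1 I\<^sub>2 I\<^sub>3" for I\<^sub>1 I\<^sub>2 I\<^sub>3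
    by (simp add: loop_sum_def F_def qmul.add_left qmul.add_right qmul.minus_left qmul.minus_right
        qmul.diff_left qmul.diff_right)
  have "C_poly m (loop_sum k v) (cofac (avgq k P v)) =
     (\<Sum>s\<^sub>1\<in>signs. \<Sum>s\<^sub>2\<in>signs. \<Sum>I\<^sub>1\<in>UNIV. \<Sum>I\<^sub>2\<in>UNIV. \<Sum>I\<^sub>3\<in>UNIV.
        of_int (s\<^sub>1 * s\<^sub>2) * levi_civita I\<^sub>1 I\<^sub>2 I\<^sub>3 * F s\<^sub>1 s\<^sub>2 I\<^sub>1 I\<^sub>2 I\<^sub>3)"
    unfolding C_poly_def expand
    by (simp add: algebra_simps sum.distrib sum_subtractf sum_negf)
  thus ?thesis
    using C_comp_phase_of [OF assms, of \<kappa> m] by (simp only: F_def)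
qed

text \<open>As \<open>g\<close> vanishes at \<open>x\<close>, the difference quotient of the product
  is \<open>f\<close> times that of \<open>g\<close>. Edge lengths and inverse norms in the
  curvature are thereby handled by continuity alone.\<close>

lemma isCont_mult_zero_has_derivative:
  fixes f g :: "real \<Rightarrow> real"
  assumes "isCont f x" "g x = 0" "(g has_real_derivative D) (at x)"
  shows "((\<lambda>t. f t * g t) has_real_derivative f x * D) (at x)"
proof -
  have "(\<lambda>t. f t * ((g t - g x) / (t - x))) \<midarrow>x\<rightarrow> f x * D"
    using assms by (intro tendsto_mult) (auto simp: isCont_def has_field_derivative_iff)
  thus ?thesis using assms(2) by (simp add: has_field_derivative_iff)
qed

section \<open>Signed sums over the four loops in a coordinate plane\<close>

definition loop_var :: "quat \<Rightarrow> quat \<Rightarrow> quat \<Rightarrow> quat \<Rightarrow> quat \<Rightarrow> quat \<Rightarrow> quat" where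
  "loop_var b\<^sub>1 b\<^sub>2 g\<^sub>1 g\<^sub>2 g\<^sub>3 g\<^sub>4 =
     qmul (qmul (qmul g\<^sub>1 b\<^sub>2) (qcnj b\<^sub>1)) (qcnj b\<^sub>2) + qmul (qmul (qmul b\<^sub>1 g\<^sub>2) (qcnj b\<^sub>1)) (qcnj b\<^sub>2) +
     qmul (qmul (qmul b\<^sub>1 b\<^sub>2) (qcnj g\<^sub>3)) (qcnj b\<^sub>2) + qmul (qmul (qmul b\<^sub>1 b\<^sub>2) (qcnj b\<^sub>1)) (qcnj g\<^sub>4)"

definition sign_cnj :: "int \<Rightarrow> quat \<Rightarrow> quat" where
  "sign_cnj s g = (if s = 1 then g else qcnj g)"

lemma linear_qcnj: "linear qcnj"
  using bounded_linear_qcnj by (simp add: linear_conv_bounded_linear)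

text \<open>\<open>loop_var\<close> is the product rule for \<open>b1 b2 b1^-1 b2^-1\<close>, with
  one velocity for each side of the square, hence jointly linear in the four velocities. This lets
  the sum over vertices act on the velocities themselves.\<close>

lemma sum_loop_var:
  "(\<Sum>v\<in>A. loop_var b\<^sub>1 b\<^sub>2 (g\<^sub>1 v) (g\<^sub>2 v) (g\<^sub>3 v) (g\<^sub>4 v)) =
   loop_var b\<^sub>1 b\<^sub>2 (\<Sum>v\<in>A. g\<^sub>1 v) (\<Sum>v\<in>A. g\<^sub>2 v) (\<Sum>v\<in>A. g\<^sub>3 v) (\<Sum>v\<in>A. g\<^sub>4 v)"
  by (simp add: loop_var_def sum.distrib qmul.sum_left qmul.sum_right linear_sum [OF linear_qcnj])

lemma fst_qmul_one_left: "fst (qmul (qmul (1, 0) q) (0, w)) = - (snd q \<bullet> w)"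
  by (simp add: qmul_def)

lemma sum_signs_product:
  "(\<Sum>s\<^sub>1\<in>signs. \<Sum>s\<^sub>2\<in>signs. of_int (s\<^sub>1 * s\<^sub>2) *\<^sub>R f s\<^sub>1 s\<^sub>2) = f 1 1 - f 1 (-1) - f (-1) 1 + f (-1) (-1)"
  for f :: "int \<Rightarrow> int \<Rightarrow> 'a::real_vector"
  by simp

text \<open>In the conjugation of \<open>q\<close> by \<open>(c, u)\<close> the only term of odd
  degree in \<open>u\<close> is twice \<open>c\<close> times the cross product of \<open>u\<close>
  with the vector part of \<open>q\<close>; everything else cancels in the difference.\<close>

lemma conj_odd_part:
  "qmul (qmul (c, u) q) (qcnj (c, u)) - qmul (qmul (c, - u) q) (qcnj (c, - u)) = (0, (4 * c) *\<^sub>R cross3 u (snd q))"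
  by (simp add: qmul_def qcnj_def prod_eq_iff vec_eq_iff forall_3 cross3_def inner_vec_def sum_3 algebra_simps)

lemma qmul_even_part:
  "qmul (c, u) (0, w) + qmul (c, - u) (0, w) = (0, (2 * c) *\<^sub>R w)"
  "qmul (0, w) (c, u) + qmul (0, w) (c, - u) = (0, (2 * c) *\<^sub>R w)"
  by (simp_all add: qmul_def vec_eq_iff)

text \<open>Bracket the loop as \<open>b1 (b2 b1^-1 b2^-1)\<close>. The sign of \<open>w\<close>
  extracts the odd part of the conjugation by \<open>b2\<close>; this is odd in \<open>u\<close>, so
  the sign of \<open>u\<close> then extracts the even part of multiplication by
  \<open>b1\<close>.\<close>

lemma loop_sum_background:
  fixes c :: real and u w :: "real^3"
  defines "L \<equiv> \<lambda>b\<^sub>1 b\<^sub>2. qmul (qmul (qmul b\<^sub>1 b\<^sub>2) (qcnj b\<^sub>1)) (qcnj b\<^sub>2)"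
  shows "L (c, u) (c, w) - L (c, u) (c, - w) - L (c, - u) (c, w) + L (c, - u) (c, - w)
    = (0, (8 * c\<^sup>2) *\<^sub>R cross3 u w)"
proof -
  have L: "L (c, u) (c, w) - L (c, u) (c, - w) = qmul (c, u) (0, (4 * c) *\<^sub>R cross3 u w)" for u
  proof -
    have "L (c, u) (c, w) - L (c, u) (c, - w) = qmul (c, u)
      (qmul (qmul (c, w) (qcnj (c, u))) (qcnj (c, w)) - qmul (qmul (c, - w) (qcnj (c, u))) (qcnj (c, - w)))"
      by (simp only: L_def qmul_assoc qmul.diff_right)
    also have "\<dots> = qmul (c, u) (0, (4 * c) *\<^sub>R cross3 u w)"
      unfolding conj_odd_part by (simp add: qcnj_def cross_skew [of w u])
    finally show ?thesis .
  qed
  have neg: "qmul q (0, - x) = - qmul q (0, x)" for q x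
    using qmul.minus_right [of q "(0, x)"] by simp
  have "L (c, u) (c, w) - L (c, u) (c, - w) - L (c, - u) (c, w) + L (c, - u) (c, - w)
     = (L (c, u) (c, w) - L (c, u) (c, - w)) - (L (c, - u) (c, w) - L (c, - u) (c, - w))"
    by simp
  also have "\<dots> = qmul (c, u) (0, (4 * c) *\<^sub>R cross3 u w) + qmul (c, - u) (0, (4 * c) *\<^sub>R cross3 u w)"
    unfolding L by (simp add: neg)
  also have "\<dots> = (0, (8 * c\<^sup>2) *\<^sub>R cross3 u w)"
    unfolding qmul_even_part by (simp add: power2_eq_square)
  finally show ?thesis .
qed

text \<open>One term per varied side of the square. In \<open>T\<^sub>1\<close> and
  \<open>T\<^sub>3\<close> the other factors form a conjugation by \<open>b2\<close>, in
  \<open>T\<^sub>2\<close> and \<open>T\<^sub>4\<close> one by \<open>b1\<close>; the odd part is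
  taken there first. The remaining sign sum gives \<open>2 c\<close>, or twice the real part of the
  velocity.\<close>

lemma loop_sum_variation:
  fixes c :: real and u w :: "real^3"
  defines "V \<equiv> \<lambda>b\<^sub>1 b\<^sub>2 g h. loop_var b\<^sub>1 b\<^sub>2 g h g h"
  shows "V (c, u) (c, w) g h - V (c, u) (c, - w) g (qcnj h) - V (c, - u) (c, w) (qcnj g) h
      + V (c, - u) (c, - w) (qcnj g) (qcnj h)
    = (0, (8 * c * (fst g + fst h)) *\<^sub>R cross3 u w + (8 * c\<^sup>2) *\<^sub>R (cross3 (snd g) w + cross3 u (snd h)))"
proof -
  define T\<^sub>1 where "T\<^sub>1 b\<^sub>1 b\<^sub>2 g = qmul g (qmul (qmul b\<^sub>2 (qcnj b\<^sub>1)) (qcnj b\<^sub>2))" for b\<^sub>1 b\<^sub>2 g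
  define T\<^sub>2 where "T\<^sub>2 b\<^sub>1 b\<^sub>2 h = qmul (qmul (qmul b\<^sub>1 h) (qcnj b\<^sub>1)) (qcnj b\<^sub>2)" for b\<^sub>1 b\<^sub>2 h
  define T\<^sub>3 where "T\<^sub>3 b\<^sub>1 b\<^sub>2 g = qmul b\<^sub>1 (qmul (qmul b\<^sub>2 (qcnj g)) (qcnj b\<^sub>2))" for b\<^sub>1 b\<^sub>2 g
  define T\<^sub>4 where "T\<^sub>4 b\<^sub>1 b\<^sub>2 h = qmul (qmul (qmul b\<^sub>1 b\<^sub>2) (qcnj b\<^sub>1)) (qcnj h)" for b\<^sub>1 b\<^sub>2 h
  have V: "V b\<^sub>1 b\<^sub>2 g h = T\<^sub>1 b\<^sub>1 b\<^sub>2 g + T\<^sub>2 b\<^sub>1 b\<^sub>2 h + T\<^sub>3 b\<^sub>1 b\<^sub>2 g + T\<^sub>4 b\<^sub>1 b\<^sub>2 h" for b\<^sub>1 b\<^sub>2 g h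
    by (simp add: V_def loop_var_def T\<^sub>1_def T\<^sub>2_def T\<^sub>3_def T\<^sub>4_def qmul_assoc)
  have plus_cnj: "g + qcnj g = (2 * fst g, 0)" for g
    by (simp add: qcnj_def prod_eq_iff)
  have real: "qmul (r, 0) (0, x) = (0, r *\<^sub>R x)" "qmul (0, x) (r, 0) = (0, r *\<^sub>R x)" for r x
    by (simp_all add: qmul_def)
  have neg: "qmul q (0, - x) = - qmul q (0, x)" "qmul (0, - x) q = - qmul (0, x) q" for q x
    using qmul.minus_right [of q "(0, x)"] qmul.minus_left [of "(0, x)" q] by simp_all
  have "T\<^sub>1 (c, u) (c, w) g - T\<^sub>1 (c, u) (c, - w) g = qmul g (0, (4 * c) *\<^sub>R cross3 u w)" for u g
    unfolding T\<^sub>1_def qmul.diff_right [symmetric] conj_odd_part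
    by (simp add: qcnj_def cross_skew [of w u])
  hence "(T\<^sub>1 (c, u) (c, w) g - T\<^sub>1 (c, u) (c, - w) g) - (T\<^sub>1 (c, - u) (c, w) (qcnj g) - T\<^sub>1 (c, - u) (c, - w) (qcnj g))
     = qmul g (0, (4 * c) *\<^sub>R cross3 u w) + qmul (qcnj g) (0, (4 * c) *\<^sub>R cross3 u w)"
    by (simp add: neg)
  hence 1: "(T\<^sub>1 (c, u) (c, w) g - T\<^sub>1 (c, u) (c, - w) g) - (T\<^sub>1 (c, - u) (c, w) (qcnj g) - T\<^sub>1 (c, - u) (c, - w) (qcnj g))
     = (0, (8 * c * fst g) *\<^sub>R cross3 u w)"
    by (simp add: qmul.add_left [symmetric] plus_cnj real)
  have "T\<^sub>3 (c, u) (c, w) g - T\<^sub>3 (c, u) (c, - w) g = qmul (c, u) (0, (4 * c) *\<^sub>R cross3 (snd g) w)" for u g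
    unfolding T\<^sub>3_def qmul.diff_right [symmetric] conj_odd_part
    by (simp add: qcnj_def cross_skew [of w "snd g"])
  hence "(T\<^sub>3 (c, u) (c, w) g - T\<^sub>3 (c, u) (c, - w) g) - (T\<^sub>3 (c, - u) (c, w) (qcnj g) - T\<^sub>3 (c, - u) (c, - w) (qcnj g))
     = qmul (c, u) (0, (4 * c) *\<^sub>R cross3 (snd g) w) + qmul (c, - u) (0, (4 * c) *\<^sub>R cross3 (snd g) w)"
    by (simp add: neg qcnj_def)
  hence 3: "(T\<^sub>3 (c, u) (c, w) g - T\<^sub>3 (c, u) (c, - w) g) - (T\<^sub>3 (c, - u) (c, w) (qcnj g) - T\<^sub>3 (c, - u) (c, - w) (qcnj g))
     = (0, (8 * c\<^sup>2) *\<^sub>R cross3 (snd g) w)"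
    by (simp add: qmul_even_part power2_eq_square)
  \<comment> \<open>From here the order is exchanged: the difference is over the sign of
    \<open>u\<close> first and over that of \<open>w\<close> afterwards.\<close>
  have "T\<^sub>2 (c, u) b h - T\<^sub>2 (c, - u) b h = qmul (0, (4 * c) *\<^sub>R cross3 u (snd h)) (qcnj b)" for b h
    unfolding T\<^sub>2_def qmul.diff_left [symmetric] conj_odd_part by simp
  hence "(T\<^sub>2 (c, u) (c, w) h - T\<^sub>2 (c, - u) (c, w) h) - (T\<^sub>2 (c, u) (c, - w) (qcnj h) - T\<^sub>2 (c, - u) (c, - w) (qcnj h))
     = qmul (0, (4 * c) *\<^sub>R cross3 u (snd h)) (c, w) + qmul (0, (4 * c) *\<^sub>R cross3 u (snd h)) (c, - w)"
    by (simp add: neg qcnj_def)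
  hence 2: "(T\<^sub>2 (c, u) (c, w) h - T\<^sub>2 (c, - u) (c, w) h) - (T\<^sub>2 (c, u) (c, - w) (qcnj h) - T\<^sub>2 (c, - u) (c, - w) (qcnj h))
     = (0, (8 * c\<^sup>2) *\<^sub>R cross3 u (snd h))"
    by (simp add: qmul_even_part power2_eq_square)
  have "T\<^sub>4 (c, u) (c, w) h - T\<^sub>4 (c, - u) (c, w) h = qmul (0, (4 * c) *\<^sub>R cross3 u w) (qcnj h)" for w h
    unfolding T\<^sub>4_def qmul.diff_left [symmetric] conj_odd_part by simp
  hence "(T\<^sub>4 (c, u) (c, w) h - T\<^sub>4 (c, - u) (c, w) h) - (T\<^sub>4 (c, u) (c, - w) (qcnj h) - T\<^sub>4 (c, - u) (c, - w) (qcnj h))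
     = qmul (0, (4 * c) *\<^sub>R cross3 u w) h + qmul (0, (4 * c) *\<^sub>R cross3 u w) (qcnj h)"
    by (simp add: neg)
  hence 4: "(T\<^sub>4 (c, u) (c, w) h - T\<^sub>4 (c, - u) (c, w) h) - (T\<^sub>4 (c, u) (c, - w) (qcnj h) - T\<^sub>4 (c, - u) (c, - w) (qcnj h))
     = (0, (8 * c * fst h) *\<^sub>R cross3 u w)"
    by (simp add: qmul.add_right [symmetric] plus_cnj real)
  have "V (c, u) (c, w) g h - V (c, u) (c, - w) g (qcnj h) - V (c, - u) (c, w) (qcnj g) h
      + V (c, - u) (c, - w) (qcnj g) (qcnj h) =
    (0, (8 * c * fst g) *\<^sub>R cross3 u w) + (0, (8 * c\<^sup>2) *\<^sub>R cross3 (snd g) w)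
    + (0, (8 * c\<^sup>2) *\<^sub>R cross3 u (snd h)) + (0, (8 * c * fst h) *\<^sub>R cross3 u w)"
    unfolding V 1 [symmetric] 2 [symmetric] 3 [symmetric] 4 [symmetric] by simp
  thus ?thesis by (simp add: algebra_simps)
qed

text \<open>A curve of unit quaternions and fluxes through the homogeneous isotropic point, with
  velocities \<open>G\<close> and \<open>W\<close>.\<close>

locale lattice_curve =
  fixes \<kappa> a \<beta> \<theta> p :: real
    and k :: "real \<Rightarrow> 'l::nontriv edge \<Rightarrow> quat" and P :: "real \<Rightarrow> 'l edge \<Rightarrow> real^3"
    and G :: "'l edge \<Rightarrow> quat" and W :: "'l edge \<Rightarrow> real^3"
  assumes \<kappa>: "\<kappa> > 0" and a: "a > 0" and \<beta>: "\<beta> > 0" and p: "p > 0" and sin: "sin \<theta> \<noteq> 0"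
    and unit: "\<And>x e. norm (k x e) = 1"
    and k0: "\<And>e. k 0 e = (cos (\<theta> / 2), sin (\<theta> / 2) *\<^sub>R axis (snd e) 1)"
    and P0: "\<And>e. P 0 e = p *\<^sub>R axis (snd e) 1"
    and dk: "\<And>e. ((\<lambda>x. k x e) has_vector_derivative G e) (at 0)"
    and dP: "\<And>e. ((\<lambda>x. P x e) has_vector_derivative W e) (at 0)"
begin

definition co :: real where "co = cos (\<theta> / 2)"
definition si :: real where "si = sin (\<theta> / 2)"
definition c :: real where "c = (\<beta> * a\<^sup>2 / 2) ^ 3"
definition V\<^sub>0 :: real where "V\<^sub>0 = sqrt (c * p ^ 3)"
definition K :: real where "K = 4 * c / (3 * \<beta> * \<kappa> * a\<^sup>2)"

definition point :: "real \<Rightarrow> 'l phase" where "point x = phase_of (k x) (P x)"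

definition qbg :: "3 \<Rightarrow> int \<Rightarrow> quat" where
  "qbg I s = (co, (of_int s * si) *\<^sub>R axis I 1)"

definition hol_var :: "'l vertex \<Rightarrow> 3 \<Rightarrow> int \<Rightarrow> quat" where
  "hol_var v I s = sign_cnj s (G (base_edge (edge_at v I s)))"

definition rot_var :: "'l edge \<Rightarrow> real^3" where
  "rot_var e = snd (qmul (qmul (qcnj (G e)) (0, P 0 e)) (k 0 e) + qmul (qmul (qcnj (k 0 e)) (0, W e)) (k 0 e)
     + qmul (qmul (qcnj (k 0 e)) (0, P 0 e)) (G e))"

definition flux_var :: "'l vertex \<Rightarrow> 3 \<Rightarrow> int \<Rightarrow> real^3" where
  "flux_var v I s = (if s = 1 then W (v, I) else - rot_var (shift v I (-1), I))"

definition avg_var :: "'l vertex \<Rightarrow> 3 \<Rightarrow> real^3" where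
  "avg_var v I = (1 / 2) *\<^sub>R (flux_var v I 1 - flux_var v I (-1))"

text \<open>The trace of the variation of the matrix with rows \<open>X_I\<close>. At a multiple of
  the identity it determines the first variation of the determinant and of the trace of the
  adjugate.\<close>

definition avg_trace :: "'l vertex \<Rightarrow> real" where
  "avg_trace v = (\<Sum>I\<in>UNIV. avg_var v I $ I)"

definition cofac_var :: "'l vertex \<Rightarrow> 3 \<Rightarrow> real^3" where
  "cofac_var v I =
     (let X = avgq (k 0) (P 0) v; D = avg_var v
      in if I = 1 then cross3 (X 2) (D 3) + cross3 (D 2) (X 3)
         else if I = 2 then cross3 (X 3) (D 1) + cross3 (D 3) (X 1)
         else cross3 (X 1) (D 2) + cross3 (D 1) (X 2))"

definition loop_sum_var :: "'l vertex \<Rightarrow> 3 \<Rightarrow> 3 \<Rightarrow> quat" where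
  "loop_sum_var v I J = (\<Sum>s\<^sub>1\<in>signs. \<Sum>s\<^sub>2\<in>signs. of_int (s\<^sub>1 * s\<^sub>2) *\<^sub>R
     loop_var (qbg I s\<^sub>1) (qbg J s\<^sub>2) (hol_var v I s\<^sub>1) (hol_var (shift v I s\<^sub>1) J s\<^sub>2)
       (hol_var (shift v J s\<^sub>2) I s\<^sub>1) (hol_var v J s\<^sub>2))"

lemma co_si: "co\<^sup>2 + si\<^sup>2 = 1" "co * co + si * si = 1"
  by (simp_all add: co_def si_def power2_eq_square [symmetric])

lemma sin_\<theta>: "sin \<theta> = 2 * si * co"
  using sin_double [of "\<theta> / 2"] by (simp add: co_def si_def)

lemma c_pos: "c > 0"
  using a \<beta> by (simp add: c_def)

lemma V\<^sub>0_pos: "V\<^sub>0 > 0" and V\<^sub>0_sq: "V\<^sub>0\<^sup>2 = c * p ^ 3"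
  using c_pos p by (simp_all add: V\<^sub>0_def)

lemma K_pos: "K > 0"
  using c_pos \<kappa> \<beta> a by (simp add: K_def)

text \<open>Differentiating \<open>|k|^2 = 1\<close> shows that the velocity is orthogonal to the
  background quaternion, whose vector part points along the edge.\<close>

lemma tangent: "co * fst (G e) + si * snd (G e) $ snd e = 0"
proof -
  have "((\<lambda>x. k x e \<bullet> k x e) has_vector_derivative (k 0 e \<bullet> G e + G e \<bullet> k 0 e)) (at 0)"
    by (intro bounded_bilinear.has_vector_derivative [OF bounded_bilinear_inner] dk)
  hence "((\<lambda>x. 1::real) has_vector_derivative (k 0 e \<bullet> G e + G e \<bullet> k 0 e)) (at 0)"
    by (simp only: dot_square_norm unit one_power2)
  hence "k 0 e \<bullet> G e + G e \<bullet> k 0 e = 0"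
    by (rule vector_derivative_unique_at) (rule has_vector_derivative_const)
  thus ?thesis
    by (simp add: inner_commute [of "G e"] inner_prod_def k0 co_def si_def inner_axis inner_axis' mult_ac)
qed

subsection \<open>Values at the homogeneous isotropic point\<close>

lemma holq_bg: "s \<in> signs \<Longrightarrow> holq (k 0) (edge_at v I s) = qbg I s"
  by (auto simp: edge_at_def k0 qbg_def co_def si_def qcnj_def)

text \<open>The background holonomy rotates about the axis of the edge, which is also the direction
  of the background flux.\<close>

lemma qrot_bg: "qrot (k 0 e) (P 0 e) = P 0 e"
proof -
  have "qrot (co, si *\<^sub>R axis I 1) (axis I 1) = (co\<^sup>2 + si\<^sup>2) *\<^sub>R axis I 1" for I :: 3
    using exhaust_3 [of I]
    by (auto simp: qrot_def qmul_def qcnj_def vec_eq_iff forall_3 cross3_def axis_def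
        inner_vec_def sum_3 power2_eq_square)
  thus ?thesis
    by (simp add: k0 P0 linear_cmul [OF linear_qrot] co_si co_def [symmetric] si_def [symmetric])
qed

lemma fluxq_bg: "s \<in> signs \<Longrightarrow> fluxq (k 0) (P 0) (edge_at v I s) = (of_int s * p) *\<^sub>R axis I 1"
  by (auto simp: edge_at_def qrot_bg) (auto simp: P0)

lemma avgq_bg: "avgq (k 0) (P 0) v I = p *\<^sub>R axis I 1"
  by (simp add: avgq_def fluxq_bg flip: scaleR_2)

lemma cofac_bg: "cofac (avgq (k 0) (P 0) v) I = p\<^sup>2 *\<^sub>R axis I 1"
  using exhaust_3 [of I]
  by (auto simp: cofac_def avgq_bg cross3_def axis_def vec_eq_iff forall_3 power2_eq_square)

lemma triple_bg: "triple (avgq (k 0) (P 0) v) = p ^ 3"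
  by (simp add: triple_def avgq_bg cross3_def axis_def inner_vec_def sum_3 power3_eq_cube)

lemma Qvol_point: "Qvol a \<beta> v (point x) = c * triple (avgq (k x) (P x) v)"
  by (simp add: point_def Qvol_phase_of unit c_def)

lemma vol_bg: "vol a \<beta> v (point 0) = V\<^sub>0"
  using c_pos p by (simp add: vol_def Qvol_point triple_bg V\<^sub>0_def)

lemma loop_sum_bg: "loop_sum (k 0) v I J = (0, (8 * co\<^sup>2 * si\<^sup>2) *\<^sub>R cross3 (axis I 1) (axis J 1))"
proof -
  have "loopq (k 0) v I s\<^sub>1 J s\<^sub>2 = qmul (qmul (qmul (qbg I s\<^sub>1) (qbg J s\<^sub>2)) (qcnj (qbg I s\<^sub>1))) (qcnj (qbg J s\<^sub>2))"
    if "s\<^sub>1 \<in> signs" "s\<^sub>2 \<in> signs" for s\<^sub>1 s\<^sub>2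
    using that by (simp only: loopq_def holq_bg)
  thus ?thesis
    using loop_sum_background [of co "si *\<^sub>R axis I 1" "si *\<^sub>R axis J 1"]
    unfolding loop_sum_def sum_signs_product
    by (simp add: qbg_def cross_mult_left cross_mult_right power2_eq_square mult_ac)
qed

text \<open>With \<open>m = (1, 0)\<close> and \<open>m = (0, axis j 1)\<close> this gives \<open>C\<close> and \<open>C\<^sub>j\<close> up to a factor.\<close>

lemma C_poly_bg:
  "C_poly m (loop_sum (k 0) v) w = 8 * co\<^sup>2 * si\<^sup>2 *
    (\<Sum>I\<in>UNIV. 2 * fst (qmul (qmul m (0, axis I 1)) (0, w I)))"
proof -
  have z: "(0, r *\<^sub>R u) = r *\<^sub>R (0::real, u)" for r and u :: "real^3" by simp
  show ?thesis
    unfolding C_poly_def loop_sum_bg z qmul.scaleR_right qmul.scaleR_left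
    by (simp add: sum_3 levi_civita_def cross_basis)
       (simp add: qmul_def algebra_simps)
qed

subsection \<open>Derivatives of the building blocks\<close>

lemma has_vector_derivative_linear:
  "linear f \<Longrightarrow> (g has_vector_derivative g') F \<Longrightarrow> ((\<lambda>x. f (g x :: 'b::euclidean_space)) has_vector_derivative f g') F"
  for f :: "'b::euclidean_space \<Rightarrow> 'c::real_normed_vector"
  by (simp add: bounded_linear.has_vector_derivative linear_conv_bounded_linear)

lemma holq_deriv:
  "s \<in> signs \<Longrightarrow> ((\<lambda>x. holq (k x) (edge_at v I s)) has_vector_derivative hol_var v I s) (at 0)"
  by (auto simp: edge_at_def hol_var_def sign_cnj_def intro!: dk has_vector_derivative_linear [OF linear_qcnj])

lemma qrot_deriv: "((\<lambda>x. qrot (k x e) (P x e)) has_vector_derivative rot_var e) (at 0)"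
proof -
  have "((\<lambda>x. (0::real, P x e)) has_vector_derivative (0, W e)) (at 0)"
    by (intro has_vector_derivative_Pair dP has_vector_derivative_const)
  hence "((\<lambda>x. qmul (qmul (qcnj (k x e)) (0, P x e)) (k x e)) has_vector_derivative
     (qmul (qmul (qcnj (k 0 e)) (0, P 0 e)) (G e) +
      qmul (qmul (qcnj (k 0 e)) (0, W e) + qmul (qcnj (G e)) (0, P 0 e)) (k 0 e))) (at 0)"
    by (intro qmul.has_vector_derivative has_vector_derivative_linear [OF linear_qcnj] dk)
  from bounded_linear.has_vector_derivative [OF bounded_linear_snd this]
  show ?thesis
    by (simp add: qrot_def rot_var_def qmul.add_left algebra_simps)
qed

lemma fluxq_deriv:
  "s \<in> signs \<Longrightarrow> ((\<lambda>x. fluxq (k x) (P x) (edge_at v I s)) has_vector_derivative flux_var v I s) (at 0)"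
  by (auto simp: edge_at_def flux_var_def intro!: dP qrot_deriv has_vector_derivative_minus)

lemma avgq_deriv: "((\<lambda>x. avgq (k x) (P x) v I) has_vector_derivative avg_var v I) (at 0)"
  unfolding avgq_def avg_var_def
  by (intro bounded_linear.has_vector_derivative [OF bounded_linear_scaleR_right]
      has_vector_derivative_diff fluxq_deriv) auto

lemma cofac_deriv: "((\<lambda>x. cofac (avgq (k x) (P x) v) I) has_vector_derivative cofac_var v I) (at 0)"
  unfolding cofac_def cofac_var_def Let_def
  using cross3.has_vector_derivative [OF avgq_deriv [of v 2] avgq_deriv [of v 3]]
    cross3.has_vector_derivative [OF avgq_deriv [of v 3] avgq_deriv [of v 1]]
    cross3.has_vector_derivative [OF avgq_deriv [of v 1] avgq_deriv [of v 2]]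
  by auto

lemma cofac_var_trace: "(\<Sum>I\<in>UNIV. cofac_var v I $ I) = 2 * p * avg_trace v"
  unfolding cofac_var_def avg_trace_def avgq_bg sum_3 Let_def
  by (simp add: cross_components) (simp add: axis_def distrib_left)

text \<open>Jacobi's formula for the determinant at \<open>p\<close> times the identity, from the
  expansion along the first row.\<close>

lemma triple_deriv:
  "((\<lambda>x. triple (avgq (k x) (P x) v)) has_real_derivative p\<^sup>2 * avg_trace v) (at 0)"
proof -
  have "((\<lambda>x. triple (avgq (k x) (P x) v)) has_vector_derivative
      (avgq (k 0) (P 0) v 1 \<bullet> cofac_var v 1 + avg_var v 1 \<bullet> cofac (avgq (k 0) (P 0) v) 1)) (at 0)"
    using bounded_bilinear.has_vector_derivative [OF bounded_bilinear_inner avgq_deriv [of v 1] cofac_deriv [of v 1]]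
    by (simp add: triple_def cofac_def)
  moreover have "avgq (k 0) (P 0) v 1 \<bullet> cofac_var v 1 + avg_var v 1 \<bullet> cofac (avgq (k 0) (P 0) v) 1 = p\<^sup>2 * avg_trace v"
    unfolding cofac_bg avgq_bg cofac_var_def avg_trace_def sum_3 Let_def
    by (simp add: inner_axis inner_axis' cross_components)
       (simp add: axis_def power2_eq_square distrib_left)
  ultimately show ?thesis
    by (simp add: has_real_derivative_iff_has_vector_derivative)
qed

lemma Qvol_deriv: "((\<lambda>x. Qvol a \<beta> v (point x)) has_real_derivative c * (p\<^sup>2 * avg_trace v)) (at 0)"
  unfolding Qvol_point by (intro DERIV_cmult triple_deriv)

lemma Qvol_bg: "Qvol a \<beta> v (point 0) = c * p ^ 3"
  by (simp add: Qvol_point triple_bg)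

lemma vol_deriv:
  "((\<lambda>x. vol a \<beta> v (point x)) has_real_derivative c * p\<^sup>2 * avg_trace v / (2 * V\<^sub>0)) (at 0)"
proof -
  have "Qvol a \<beta> v (point 0) \<noteq> 0"
    using c_pos p by (simp add: Qvol_bg)
  with has_real_derivative_sqrt_abs [OF Qvol_deriv] c_pos p
  show ?thesis
    unfolding vol_def by (simp add: Qvol_bg V\<^sub>0_def mult_ac)
qed

text \<open>The closed form of \<open>C_comp\<close> requires positive \<open>Qvol\<close>.
  Positivity near 0 suffices for transferring it under the derivative.\<close>

lemma Qvol_pos: "eventually (\<lambda>x. Qvol a \<beta> v (point x) > 0) (nhds 0)"
proof -
  have "isCont (\<lambda>x. Qvol a \<beta> v (point x)) 0" by (rule DERIV_isCont [OF Qvol_deriv])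
  moreover have pos: "Qvol a \<beta> v (point 0) > 0" using c_pos p by (simp add: Qvol_bg)
  ultimately have "eventually (\<lambda>x. Qvol a \<beta> v (point x) > 0) (at 0)"
    unfolding isCont_def by (rule order_tendstoD)
  thus ?thesis using pos by (simp add: eventually_nhds_conv_at)
qed

lemma loopq_deriv:
  assumes "s\<^sub>1 \<in> signs" "s\<^sub>2 \<in> signs"
  shows "((\<lambda>x. loopq (k x) v I s\<^sub>1 J s\<^sub>2) has_vector_derivative
     loop_var (qbg I s\<^sub>1) (qbg J s\<^sub>2) (hol_var v I s\<^sub>1) (hol_var (shift v I s\<^sub>1) J s\<^sub>2)
       (hol_var (shift v J s\<^sub>2) I s\<^sub>1) (hol_var v J s\<^sub>2)) (at 0)"
  using qmul.has_vector_derivative [OF qmul.has_vector_derivative [OF qmul.has_vector_derivative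
      [OF holq_deriv [OF assms(1), of v I] holq_deriv [OF assms(2), of "shift v I s\<^sub>1" J]]
      has_vector_derivative_linear [OF linear_qcnj holq_deriv [OF assms(1), of "shift v J s\<^sub>2" I]]]
      has_vector_derivative_linear [OF linear_qcnj holq_deriv [OF assms(2), of v J]]]
  unfolding loopq_def loop_var_def
  by (simp only: holq_bg assms qmul.add_left add_ac)

lemma loop_sum_deriv: "((\<lambda>x. loop_sum (k x) v I J) has_vector_derivative loop_sum_var v I J) (at 0)"
  unfolding loop_sum_def loop_sum_var_def
  by (intro has_vector_derivative_sum bounded_linear.has_vector_derivative [OF bounded_linear_scaleR_right]
      loopq_deriv)

subsection \<open>Derivative of the constraints\<close>

definition C_poly_var :: "quat \<Rightarrow> 'l vertex \<Rightarrow> real" where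
  "C_poly_var m v =
     C_poly m (loop_sum_var v) (cofac (avgq (k 0) (P 0) v)) + C_poly m (loop_sum (k 0) v) (cofac_var v)"

lemma C_poly_deriv:
  "((\<lambda>x. C_poly m (loop_sum (k x) v) (cofac (avgq (k x) (P x) v))) has_real_derivative C_poly_var m v) (at 0)"
proof -
  have 1: "((\<lambda>x. (0::real, cofac (avgq (k x) (P x) v) I)) has_vector_derivative (0, cofac_var v I)) (at 0)" for I
    by (intro has_vector_derivative_Pair cofac_deriv has_vector_derivative_const)
  have "((\<lambda>x. fst (qmul (qmul m (loop_sum (k x) v I J)) (0, cofac (avgq (k x) (P x) v) M))) has_real_derivative
      fst (qmul (qmul m (loop_sum (k 0) v I J)) (0, cofac_var v M)) +
      fst (qmul (qmul m (loop_sum_var v I J)) (0, cofac (avgq (k 0) (P 0) v) M))) (at 0)" for I J M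
    using bounded_linear.has_vector_derivative [OF bounded_linear_fst
        qmul.has_vector_derivative [OF bounded_linear.has_vector_derivative
          [OF qmul.bounded_linear_right [of m] loop_sum_deriv [of v I J]] 1 [of M]]]
    by (simp add: has_real_derivative_iff_has_vector_derivative)
  hence "((\<lambda>x. C_poly m (loop_sum (k x) v) (cofac (avgq (k x) (P x) v))) has_real_derivative
     (\<Sum>I\<in>UNIV. \<Sum>J\<in>UNIV. \<Sum>M\<in>UNIV. levi_civita I J M * (fst (qmul (qmul m (loop_sum (k 0) v I J)) (0, cofac_var v M)) +
      fst (qmul (qmul m (loop_sum_var v I J)) (0, cofac (avgq (k 0) (P 0) v) M))))) (at 0)"
    unfolding C_poly_def by (intro DERIV_sum DERIV_cmult)
  thus ?thesis
    by (simp add: C_poly_var_def C_poly_def algebra_simps sum.distrib)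
qed

text \<open>Quotient rule for the closed form valid near 0: the first term varies loops and
  cofactors, the second the volume in the denominator.\<close>

lemma C_comp_deriv:
  "((\<lambda>x. C_comp \<kappa> a \<beta> (qmat m) v (point x)) has_real_derivative
     - K / V\<^sub>0 * C_poly_var m v + K / V\<^sub>0\<^sup>2 * (c * p\<^sup>2 * avg_trace v / (2 * V\<^sub>0)) *
       C_poly m (loop_sum (k 0) v) (cofac (avgq (k 0) (P 0) v))) (at 0)" (is "(_ has_real_derivative ?D) _")
proof -
  have "eventually (\<lambda>x. C_comp \<kappa> a \<beta> (qmat m) v (point x) =
     - K / vol a \<beta> v (point x) * C_poly m (loop_sum (k x) v) (cofac (avgq (k x) (P x) v))) (nhds 0)"
    using Qvol_pos [of v]
    by eventually_elim (simp add: point_def C_comp_C_poly unit K_def c_def)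
  moreover have "((\<lambda>x. - K / vol a \<beta> v (point x) * C_poly m (loop_sum (k x) v) (cofac (avgq (k x) (P x) v)))
      has_real_derivative ?D) (at 0)"
    using V\<^sub>0_pos
    by (auto intro!: derivative_eq_intros vol_deriv C_poly_deriv simp: vol_bg power2_eq_square field_simps)
  ultimately show ?thesis by (subst DERIV_cong_ev [OF refl _ refl])
qed

lemma C_comp_bg:
  "C_comp \<kappa> a \<beta> (qmat m) v (point 0) = - K / V\<^sub>0 * C_poly m (loop_sum (k 0) v) (\<lambda>I. p\<^sup>2 *\<^sub>R axis I 1)"
proof -
  have "Qvol a \<beta> v (point 0) > 0" using c_pos p by (simp add: Qvol_bg)
  thus ?thesis
    using C_comp_C_poly [of "k 0" a \<beta> v "P 0" \<kappa> m] unit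
    by (simp add: point_def [symmetric] vol_bg K_def c_def cofac_bg [abs_def])
qed

text \<open>The real part of the product of the axes \<open>j\<close>, \<open>I\<close>,
  \<open>I\<close> is a scalar triple product with a repeated vector. Hence the squares of these
  constraints are stationary at the background.\<close>

lemma C_comp_tau_bg: "C_comp \<kappa> a \<beta> (tau j) v (point 0) = 0"
proof -
  have "fst (qmul (qmul (0, axis j 1) (0, axis I 1)) (0, p\<^sup>2 *\<^sub>R axis I 1)) = 0" for I
    by (simp add: qmul_def dot_cross_self)
  thus ?thesis by (simp add: qmat_tau [symmetric] C_comp_bg C_poly_bg)
qed

text \<open>The three axes contribute equally, and \<open>sin \<theta> = 2 si co\<close> turns
  \<open>48 co^2 si^2\<close> into \<open>12 (sin \<theta>)^2\<close>.\<close>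

lemma C_comp_one_bg: "C_comp \<kappa> a \<beta> (mat 1) v (point 0) = 12 * K * p\<^sup>2 * (sin \<theta>)\<^sup>2 / V\<^sub>0"
  by (simp add: qmat_one [symmetric] C_comp_bg C_poly_bg fst_qmul_one_left sum_3 inner_axis sin_\<theta>
      power2_eq_square)

end

section \<open>First variations summed over all vertices\<close>

lemma sum_shift:
  fixes f :: "'l::nontriv vertex \<Rightarrow> 'b::comm_monoid_add"
  shows "(\<Sum>v\<in>UNIV. f (shift v I s)) = (\<Sum>v\<in>UNIV. f v)"
proof -
  have "axis I (of_int (- s)) + axis I (of_int s) = (0 :: 'l vertex)"
    by (simp add: vec_eq_iff axis_def)
  hence inv: "shift (shift v I s) I (- s) = v" "shift (shift v I (- s)) I s = v" for v :: "'l vertex"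
    by (simp_all add: shift_def add.assoc add.commute [of "axis I (of_int s)"])
  show ?thesis
    by (rule sum.reindex_bij_witness [of _ "\<lambda>v. shift v I (- s)" "\<lambda>v. shift v I s"]) (simp_all only: inv UNIV_I)
qed

text \<open>Conjugation by \<open>(c, s e)\<close> rotates about axis \<open>I\<close> and rescales,
  so the parallel component of \<open>w\<close> is only multiplied by the squared norm. The two
  terms in \<open>g\<close> combine to \<open>2 p\<close> times the inner product of
  \<open>g\<close> with the background quaternion, which vanishes for tangent velocities.\<close>

lemma qrot_variation:
  fixes c s :: real and I :: 3
  defines "e \<equiv> axis I 1 :: real^3"
  shows "snd (qmul (qmul (qcnj g) (0, p *\<^sub>R e)) (c, s *\<^sub>R e) + qmul (qmul (qcnj (c, s *\<^sub>R e)) (0, w)) (c, s *\<^sub>R e)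
      + qmul (qmul (qcnj (c, s *\<^sub>R e)) (0, p *\<^sub>R e)) g) $ I
    = 2 * p * (c * fst g + s * snd g $ I) + (c * c + s * s) * w $ I"
  using exhaust_3 [of I] unfolding e_def
  by (elim disjE; simp add: qmul_def qcnj_def cross_components inner_axis inner_axis' inner_vec_def sum_3;
      simp add: axis_def distrib_left distrib_right)

lemma C_poly_sum:
  "(\<Sum>v\<in>A. C_poly m (L v) w) = C_poly m (\<lambda>I J. \<Sum>v\<in>A. L v I J) w"
  unfolding C_poly_def sum_3 sum.distrib
  by (simp add: qmul.sum_left qmul.sum_right fst_sum sum_distrib_left)

context lattice_curve
begin

definition G_tot :: "3 \<Rightarrow> quat" where "G_tot I = (\<Sum>v\<in>UNIV. G (v, I))"

text \<open>The first variation of the sum over all edges of \<open>q_0 q_I\<close>, a quantity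
  equal to \<open>sin \<theta> / 2\<close> on each background edge.\<close>

definition angle_tot :: real where
  "angle_tot = (\<Sum>I\<in>UNIV. si * fst (G_tot I) + co * snd (G_tot I) $ I)"

definition flux_tot :: real where
  "flux_tot = (\<Sum>I\<in>UNIV. \<Sum>v\<in>UNIV. W (v, I) $ I)"

lemma sum_hol_var: "s \<in> signs \<Longrightarrow> (\<Sum>v\<in>UNIV. hol_var v I s) = sign_cnj s (G_tot I)"
  using sum_shift [of "\<lambda>v. qcnj (G (v, I))" I "-1"]
  by (auto simp: hol_var_def sign_cnj_def edge_at_def G_tot_def linear_sum [OF linear_qcnj])

text \<open>After summation over \<open>v\<close>, opposite sides of the square have the same total
  velocity up to conjugation by translation invariance; this is the pattern \<open>g h g h\<close>
  of \<open>loop_sum_variation\<close>.\<close>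

lemma sum_loop_sum_var:
  "(\<Sum>v\<in>UNIV. loop_sum_var v I J) =
    (0, (8 * co * si\<^sup>2 * (fst (G_tot I) + fst (G_tot J))) *\<^sub>R cross3 (axis I 1) (axis J 1)
      + (8 * co\<^sup>2 * si) *\<^sub>R (cross3 (snd (G_tot I)) (axis J 1) + cross3 (axis I 1) (snd (G_tot J))))"
proof -
  have "(\<Sum>v\<in>UNIV. loop_var (qbg I s\<^sub>1) (qbg J s\<^sub>2) (hol_var v I s\<^sub>1) (hol_var (shift v I s\<^sub>1) J s\<^sub>2)
       (hol_var (shift v J s\<^sub>2) I s\<^sub>1) (hol_var v J s\<^sub>2))
     = loop_var (qbg I s\<^sub>1) (qbg J s\<^sub>2) (sign_cnj s\<^sub>1 (G_tot I)) (sign_cnj s\<^sub>2 (G_tot J))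
         (sign_cnj s\<^sub>1 (G_tot I)) (sign_cnj s\<^sub>2 (G_tot J))" if "s\<^sub>1 \<in> signs" "s\<^sub>2 \<in> signs" for s\<^sub>1 s\<^sub>2
    using that sum_shift [of "\<lambda>v. hol_var v J s\<^sub>2" I s\<^sub>1] sum_shift [of "\<lambda>v. hol_var v I s\<^sub>1" J s\<^sub>2]
    by (simp only: sum_loop_var sum_hol_var)
  hence "(\<Sum>v\<in>UNIV. loop_sum_var v I J) = (\<Sum>s\<^sub>1\<in>signs. \<Sum>s\<^sub>2\<in>signs. of_int (s\<^sub>1 * s\<^sub>2) *\<^sub>R
      loop_var (qbg I s\<^sub>1) (qbg J s\<^sub>2) (sign_cnj s\<^sub>1 (G_tot I)) (sign_cnj s\<^sub>2 (G_tot J))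
         (sign_cnj s\<^sub>1 (G_tot I)) (sign_cnj s\<^sub>2 (G_tot J)))"
    unfolding loop_sum_var_def sum_signs_product sum.distrib sum_subtractf by simp
  also have "\<dots> = (0, (8 * co * (fst (G_tot I) + fst (G_tot J))) *\<^sub>R cross3 (si *\<^sub>R axis I 1) (si *\<^sub>R axis J 1)
      + (8 * co\<^sup>2) *\<^sub>R (cross3 (snd (G_tot I)) (si *\<^sub>R axis J 1) + cross3 (si *\<^sub>R axis I 1) (snd (G_tot J))))"
    unfolding sum_signs_product loop_sum_variation [symmetric] by (simp add: qbg_def sign_cnj_def)
  also have "\<dots> = (0, (8 * co * si\<^sup>2 * (fst (G_tot I) + fst (G_tot J))) *\<^sub>R cross3 (axis I 1) (axis J 1)
      + (8 * co\<^sup>2 * si) *\<^sub>R (cross3 (snd (G_tot I)) (axis J 1) + cross3 (axis I 1) (snd (G_tot J))))"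
    by (simp add: cross_mult_left cross_mult_right scaleR_add_right power2_eq_square mult_ac)
  finally show ?thesis .
qed

text \<open>The background cofactor lies along the third axis, and the triple product of
  \<open>snd (G_tot I)\<close> with the other two axes keeps only the component \<open>I\<close>.
  Perpendicular angle velocities drop out here.\<close>

lemma sum_C_poly_loop_var:
  "(\<Sum>v\<in>UNIV. C_poly (1, 0) (loop_sum_var v) (cofac (avgq (k 0) (P 0) v))) = - (32 * p\<^sup>2 * co * si * angle_tot)"
proof -
  have "(\<Sum>v\<in>UNIV. C_poly (1, 0) (loop_sum_var v) (cofac (avgq (k 0) (P 0) v)))
      = C_poly (1, 0) (\<lambda>I J. \<Sum>v\<in>UNIV. loop_sum_var v I J) (\<lambda>I. p\<^sup>2 *\<^sub>R axis I 1)"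
    by (simp only: cofac_bg [abs_def] C_poly_sum)
  also have "\<dots> = - (32 * p\<^sup>2 * co * si * angle_tot)"
    unfolding C_poly_def fst_qmul_one_left sum_loop_sum_var sum_3 angle_tot_def
    by (simp add: levi_civita_def inner_axis cross_components)
       (simp add: axis_def power2_eq_square algebra_simps)
  finally show ?thesis .
qed

lemma rot_var_parallel: "rot_var (v, I) $ I = W (v, I) $ I"
  unfolding rot_var_def k0 P0 snd_conv qrot_variation
  using tangent [of "(v, I)"] co_si(2) by (simp add: co_def si_def)

text \<open>Each edge enters the averages at both of its endpoints with weight one half; the
  rotation at the far endpoint preserves the parallel component.\<close>

lemma sum_avg_trace: "(\<Sum>v\<in>UNIV. avg_trace v) = flux_tot"
proof -
  have "avg_trace v = (\<Sum>I\<in>UNIV. (W (v, I) $ I + W (shift v I (-1), I) $ I) / 2)" for v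
    by (simp add: avg_trace_def avg_var_def flux_var_def rot_var_parallel)
  hence "(\<Sum>v\<in>UNIV. avg_trace v) = (\<Sum>I\<in>UNIV. \<Sum>v\<in>UNIV. (W (v, I) $ I + W (shift v I (-1), I) $ I) / 2)"
    by (simp only: sum.swap [of _ "UNIV :: 'l vertex set"])
  also have "\<dots> = flux_tot"
    using sum_shift [of "\<lambda>v. W (v, I) $ I" I "-1" for I]
    by (simp add: flux_tot_def sum_divide_distrib [symmetric] sum.distrib)
  finally show ?thesis .
qed

lemma sum_C_poly_var:
  "(\<Sum>v\<in>UNIV. C_poly_var (1, 0) v) = - (32 * p\<^sup>2 * co * si * angle_tot) - 32 * p * co\<^sup>2 * si\<^sup>2 * flux_tot"
proof -
  have "C_poly (1, 0) (loop_sum (k 0) v) (cofac_var v) = - (32 * p * co\<^sup>2 * si\<^sup>2) * avg_trace v" for v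
  proof -
    have "C_poly (1, 0) (loop_sum (k 0) v) (cofac_var v) = - (16 * co\<^sup>2 * si\<^sup>2) * (\<Sum>I\<in>UNIV. cofac_var v I $ I)"
      unfolding C_poly_bg by (simp add: fst_qmul_one_left inner_axis' sum_negf sum_distrib_left [symmetric])
    thus ?thesis by (simp add: cofac_var_trace)
  qed
  thus ?thesis
    unfolding C_poly_var_def sum.distrib sum_C_poly_loop_var
    by (simp add: sum_distrib_left [symmetric] sum_avg_trace sum_negf)
qed

definition C_var :: "'l vertex \<Rightarrow> real" where
  "C_var v = - K / V\<^sub>0 * C_poly_var (1, 0) v + K / V\<^sub>0\<^sup>2 * (c * p\<^sup>2 * avg_trace v / (2 * V\<^sub>0)) *
       C_poly (1, 0) (loop_sum (k 0) v) (cofac (avgq (k 0) (P 0) v))"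

lemma C_one_deriv: "((\<lambda>x. C_comp \<kappa> a \<beta> (mat 1) v (point x)) has_real_derivative C_var v) (at 0)"
  using C_comp_deriv [of "(1, 0)"] by (simp add: qmat_one C_var_def)

lemma sum_C_var:
  "(\<Sum>v\<in>UNIV. C_var v) = K / V\<^sub>0 * (16 * p\<^sup>2 * sin \<theta> * angle_tot + 2 * p * (sin \<theta>)\<^sup>2 * flux_tot)"
proof -
  have bg: "C_poly (1, 0) (loop_sum (k 0) v) (cofac (avgq (k 0) (P 0) v)) = - (48 * co\<^sup>2 * si\<^sup>2 * p\<^sup>2)" for v
    by (simp add: C_poly_bg cofac_bg [abs_def] fst_qmul_one_left sum_3 inner_axis)
  \<comment> \<open>By \<open>V\<^sub>0\<^sup>2 = c * p ^ 3\<close> the variation of the inverse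
    volume becomes comparable with that of the cofactors, and cancels three quarters of it.\<close>
  have trace: "K / V\<^sub>0\<^sup>2 * (c * p\<^sup>2 * t / (2 * V\<^sub>0)) * - (48 * co\<^sup>2 * si\<^sup>2 * p\<^sup>2) = - (24 * p * co\<^sup>2 * si\<^sup>2 * K / V\<^sub>0) * t" for t
    unfolding V\<^sub>0_sq using c_pos p by (simp add: field_simps power2_eq_square power3_eq_cube)
  have "C_var v = - K / V\<^sub>0 * C_poly_var (1, 0) v - (24 * p * co\<^sup>2 * si\<^sup>2 * K / V\<^sub>0) * avg_trace v" for v
    unfolding C_var_def bg trace by simp
  hence "(\<Sum>v\<in>UNIV. C_var v) = - K / V\<^sub>0 * (\<Sum>v\<in>UNIV. C_poly_var (1, 0) v)
      - (24 * p * co\<^sup>2 * si\<^sup>2 * K / V\<^sub>0) * (\<Sum>v\<in>UNIV. avg_trace v)"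
    by (simp add: sum_subtractf sum_distrib_left sum_negf)
  also have "\<dots> = K / V\<^sub>0 * (16 * p\<^sup>2 * sin \<theta> * angle_tot + 2 * p * (sin \<theta>)\<^sup>2 * flux_tot)"
    unfolding sum_C_poly_var sum_avg_trace sin_\<theta> by (simp add: algebra_simps power2_eq_square)
  finally show ?thesis .
qed

subsection \<open>The curvature\<close>

lemma flux_point: "flux (point x) oe = fluxq (k x) (P x) oe"
  by (simp add: point_def flux_phase_of unit)

lemma norm_cross_axis:
  assumes "I \<noteq> J"
  shows "norm (cross3 (axis I 1) (axis J (1::real))) = 1"
proof -
  have "(norm (cross3 (axis I 1) (axis J (1::real))))\<^sup>2 = 1"
    using norm_cross_dot [of "axis I 1" "axis J 1"] assms by (simp add: inner_axis_axis)
  thus ?thesis by (simp add: power2_eq_1_iff) (smt (verit) norm_ge_zero)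
qed

lemma edge_length_bg:
  assumes "I \<noteq> J" "s\<^sub>1 \<in> signs" "s\<^sub>2 \<in> signs"
  shows "edge_length a \<beta> v I s\<^sub>1 J s\<^sub>2 (point 0) = p\<^sup>2 / V\<^sub>0"
proof -
  have "\<bar>real_of_int s\<^sub>1\<bar> = 1" "\<bar>real_of_int s\<^sub>2\<bar> = 1" using assms by auto
  thus ?thesis
    unfolding edge_length_def flux_point fluxq_bg [OF assms(2)] fluxq_bg [OF assms(3)] vol_bg
    using p by (simp add: cross_mult_left cross_mult_right norm_cross_axis assms(1) abs_mult power2_eq_square)
qed

lemma isCont_edge_length:
  assumes "s\<^sub>1 \<in> signs" "s\<^sub>2 \<in> signs"
  shows "isCont (\<lambda>x. edge_length a \<beta> v I s\<^sub>1 J s\<^sub>2 (point x)) 0"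
proof -
  have "isCont (\<lambda>x. vol a \<beta> v (point x)) 0" by (rule DERIV_isCont [OF vol_deriv])
  moreover have "isCont (\<lambda>x. fluxq (k x) (P x) (edge_at v I s)) 0" if "s \<in> signs" for I s
    using that by (rule has_vector_derivative_continuous [OF fluxq_deriv])
  ultimately show ?thesis
    unfolding edge_length_def flux_point using V\<^sub>0_pos assms
    by (intro continuous_intros continuous_cross) (simp_all add: vol_bg)
qed

text \<open>Background fluxes along different axes are orthogonal, so the angle is
  \<open>pi / 2\<close> and the deficit vanishes. The derivative of \<open>arccos\<close> at 0 is
  -1, and the norms contribute through their background value \<open>p\<close> only.\<close>

lemma angle_deriv:
  fixes v :: "'l vertex" and I J :: 3 and s\<^sub>1 s\<^sub>2 :: int
  assumes "I \<noteq> J" and s: "s\<^sub>1 \<in> signs" "s\<^sub>2 \<in> signs"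
  defines "A \<equiv> \<lambda>x. 2 * pi / 4 - pi + arccos ((flux (point x) (edge_at v I s\<^sub>1) \<bullet> flux (point x) (edge_at v J s\<^sub>2))
                 / (norm (flux (point x) (edge_at v I s\<^sub>1)) * norm (flux (point x) (edge_at v J s\<^sub>2))))"
  shows "A 0 = 0"
    and "(A has_real_derivative - (s\<^sub>2 * flux_var v I s\<^sub>1 $ J + s\<^sub>1 * flux_var v J s\<^sub>2 $ I) / p) (at 0)"
proof -
  define f where "f x = fluxq (k x) (P x) (edge_at v I s\<^sub>1)" for x
  define g where "g x = fluxq (k x) (P x) (edge_at v J s\<^sub>2)" for x
  \<comment> \<open>The cosine is written as a continuous factor times an inner product vanishing at
    0, the form needed for \<open>isCont_mult_zero_has_derivative\<close>.\<close>
  define u where "u x = (1 / (norm (f x) * norm (g x))) * (f x \<bullet> g x)" for x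
  have A: "A = (\<lambda>x. 2 * pi / 4 - pi + arccos (u x))"
    by (simp add: A_def u_def f_def g_def flux_point fun_eq_iff)
  have abs: "\<bar>real_of_int s\<^sub>1\<bar> = 1" "\<bar>real_of_int s\<^sub>2\<bar> = 1" using s by auto
  have f0: "f 0 = (of_int s\<^sub>1 * p) *\<^sub>R axis I 1" and g0: "g 0 = (of_int s\<^sub>2 * p) *\<^sub>R axis J 1"
    using s by (simp_all only: f_def g_def fluxq_bg)
  have norms: "norm (f 0) = p" "norm (g 0) = p"
    using p abs by (simp_all add: f0 g0 abs_mult)
  have fg0: "f 0 \<bullet> g 0 = 0" using \<open>I \<noteq> J\<close> by (simp add: f0 g0 inner_axis_axis)
  hence u0: "u 0 = 0" by (simp add: u_def)
  show "A 0 = 0" by (simp add: A u0)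
  have df: "(f has_vector_derivative flux_var v I s\<^sub>1) (at 0)" and dg: "(g has_vector_derivative flux_var v J s\<^sub>2) (at 0)"
    unfolding f_def g_def by (rule fluxq_deriv [OF s(1)], rule fluxq_deriv [OF s(2)])
  have "((\<lambda>x. f x \<bullet> g x) has_real_derivative (f 0 \<bullet> flux_var v J s\<^sub>2 + flux_var v I s\<^sub>1 \<bullet> g 0)) (at 0)"
    unfolding has_real_derivative_iff_has_vector_derivative
    by (rule bounded_bilinear.has_vector_derivative [OF bounded_bilinear_inner df dg])
  moreover have "isCont (\<lambda>x. 1 / (norm (f x) * norm (g x))) 0"
    using has_vector_derivative_continuous [OF df] has_vector_derivative_continuous [OF dg] p norms
    by (intro continuous_intros) simp_all
  ultimately have "(u has_real_derivative 1 / (norm (f 0) * norm (g 0)) *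
     (f 0 \<bullet> flux_var v J s\<^sub>2 + flux_var v I s\<^sub>1 \<bullet> g 0)) (at 0)"
    unfolding u_def by (intro isCont_mult_zero_has_derivative fg0)
  hence "(u has_real_derivative (s\<^sub>2 * flux_var v I s\<^sub>1 $ J + s\<^sub>1 * flux_var v J s\<^sub>2 $ I) / p) (at 0)"
    by (rule DERIV_cong) (unfold norms, use p in \<open>simp add: f0 g0 inner_axis inner_axis' field_simps\<close>)
  hence "((\<lambda>x. arccos (u x)) has_real_derivative
      inverse (- sqrt (1 - (u 0)\<^sup>2)) * ((s\<^sub>2 * flux_var v I s\<^sub>1 $ J + s\<^sub>1 * flux_var v J s\<^sub>2 $ I) / p)) (at 0)"
    by (intro DERIV_chain2 [where f = arccos] DERIV_arccos) (simp_all add: u0)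
  hence "((\<lambda>x. 2 * pi / 4 - pi + arccos (u x)) has_real_derivative
      0 + inverse (- sqrt (1 - (u 0)\<^sup>2)) * ((s\<^sub>2 * flux_var v I s\<^sub>1 $ J + s\<^sub>1 * flux_var v J s\<^sub>2 $ I) / p)) (at 0)"
    by (intro DERIV_add DERIV_const)
  thus "(A has_real_derivative - (s\<^sub>2 * flux_var v I s\<^sub>1 $ J + s\<^sub>1 * flux_var v J s\<^sub>2 $ I) / p) (at 0)"
    by (simp add: A u0)
qed

lemma curvature_bg: "curvature a \<beta> v (point 0) = 0"
  unfolding curvature_def
  by (intro sum.neutral ballI, rule mult_eq_0_iff [THEN iffD2], rule disjI2, rule angle_deriv(1)) auto

text \<open>The two orientations of each edge contribute with opposite signs.\<close>

lemma curvature_deriv: "((\<lambda>x. curvature a \<beta> v (point x)) has_real_derivative 0) (at 0)"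
proof -
  have "((\<lambda>x. curvature a \<beta> v (point x)) has_real_derivative
     (\<Sum>I\<in>UNIV. \<Sum>J\<in>UNIV - {I}. \<Sum>s\<^sub>1\<in>signs. \<Sum>s\<^sub>2\<in>signs.
       p\<^sup>2 / V\<^sub>0 * (- (s\<^sub>2 * flux_var v I s\<^sub>1 $ J + s\<^sub>1 * flux_var v J s\<^sub>2 $ I) / p))) (at 0)"
    unfolding curvature_def
  proof (intro DERIV_sum)
    fix I J :: 3 and s\<^sub>1 s\<^sub>2 :: int
    assume "J \<in> UNIV - {I}" and s: "s\<^sub>1 \<in> signs" "s\<^sub>2 \<in> signs"
    hence IJ: "I \<noteq> J" by auto
    show "((\<lambda>x. edge_length a \<beta> v I s\<^sub>1 J s\<^sub>2 (point x) * (2 * pi / 4 - pi +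
         arccos ((flux (point x) (edge_at v I s\<^sub>1) \<bullet> flux (point x) (edge_at v J s\<^sub>2))
                 / (norm (flux (point x) (edge_at v I s\<^sub>1)) * norm (flux (point x) (edge_at v J s\<^sub>2))))))
       has_real_derivative p\<^sup>2 / V\<^sub>0 * (- (s\<^sub>2 * flux_var v I s\<^sub>1 $ J + s\<^sub>1 * flux_var v J s\<^sub>2 $ I) / p)) (at 0)"
      unfolding edge_length_bg [OF IJ s, of v, symmetric]
      by (intro isCont_mult_zero_has_derivative isCont_edge_length angle_deriv IJ s)
  qed
  moreover have "(\<Sum>s\<^sub>1\<in>signs. \<Sum>s\<^sub>2\<in>signs.
       p\<^sup>2 / V\<^sub>0 * (- (s\<^sub>2 * flux_var v I s\<^sub>1 $ J + s\<^sub>1 * flux_var v J s\<^sub>2 $ I) / p)) = 0" for I J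
    by (simp add: algebra_simps add_divide_distrib diff_divide_distrib)
  ultimately show ?thesis by (simp only: sum.neutral_const)
qed

subsection \<open>Derivative of the Hamiltonians\<close>

definition C\<^sub>0 :: real where "C\<^sub>0 = 12 * K * p\<^sup>2 * (sin \<theta>)\<^sup>2 / V\<^sub>0"

lemma C\<^sub>0_pos: "C\<^sub>0 > 0"
  using K_pos V\<^sub>0_pos p sin by (simp add: C\<^sub>0_def)

lemma C_AALM_bg: "C_AALM \<kappa> a \<beta> v (point 0) = - C\<^sub>0 / \<beta>\<^sup>2"
  by (simp add: C_AALM_def C_comp_one_bg curvature_bg C\<^sub>0_def)

lemma C_AALM_deriv: "((\<lambda>x. C_AALM \<kappa> a \<beta> v (point x)) has_real_derivative - C_var v / \<beta>\<^sup>2) (at 0)"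
  unfolding C_AALM_def
  using DERIV_diff [OF DERIV_cmult [OF C_one_deriv, of "- (1 / \<beta>\<^sup>2)"]
      DERIV_cmult [OF curvature_deriv, of "(1 + \<beta>\<^sup>2) / (\<kappa> * \<beta>\<^sup>2)"]]
  by simp

text \<open>The vector constraints enter quadratically and vanish at the background, so each summand
  has the first variation of \<open>|C_v| = - C_v\<close>, the background value of
  \<open>C_AALM\<close> being negative.\<close>

lemma H_dust_deriv':
  "((\<lambda>x. H_dust \<kappa> a \<beta> \<alpha> (point x)) has_real_derivative (\<Sum>v\<in>UNIV. C_var v) / \<beta>\<^sup>2) (at 0)"
proof -
  have "((\<lambda>x. sqrt \<bar>(C_AALM \<kappa> a \<beta> v (point x))\<^sup>2 - \<alpha> / 4 * (\<Sum>j\<in>UNIV. (C_comp \<kappa> a \<beta> (tau j) v (point x))\<^sup>2)\<bar>)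
     has_real_derivative C_var v / \<beta>\<^sup>2) (at 0)" for v
  proof -
    have "\<exists>D. ((\<lambda>x. C_comp \<kappa> a \<beta> (tau j) v (point x)) has_real_derivative D) (at 0)" for j
      using C_comp_deriv [of "(0, axis j 1)" v] by (auto simp: qmat_tau)
    then obtain D where D: "((\<lambda>x. C_comp \<kappa> a \<beta> (tau j) v (point x)) has_real_derivative D j) (at 0)" for j
      by metis
    have "((\<lambda>x. (C_comp \<kappa> a \<beta> (tau j) v (point x))\<^sup>2) has_real_derivative 0) (at 0)" for j
      by (auto intro!: derivative_eq_intros D simp: C_comp_tau_bg)
    hence S: "((\<lambda>x. \<Sum>j\<in>UNIV. (C_comp \<kappa> a \<beta> (tau j) v (point x))\<^sup>2) has_real_derivative (\<Sum>j\<in>(UNIV::3 set). 0)) (at 0)"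
      by (intro DERIV_sum)
    have F: "((\<lambda>x. (C_AALM \<kappa> a \<beta> v (point x))\<^sup>2 - \<alpha> / 4 * (\<Sum>j\<in>UNIV. (C_comp \<kappa> a \<beta> (tau j) v (point x))\<^sup>2))
      has_real_derivative 2 * (C\<^sub>0 / \<beta>\<^sup>2) * (C_var v / \<beta>\<^sup>2)) (at 0)"
      by (rule DERIV_cong [OF DERIV_diff [OF DERIV_power [OF C_AALM_deriv] DERIV_cmult [OF S]]])
         (simp add: C_AALM_bg)
    have F0: "(C_AALM \<kappa> a \<beta> v (point 0))\<^sup>2 - \<alpha> / 4 * (\<Sum>j\<in>UNIV. (C_comp \<kappa> a \<beta> (tau j) v (point 0))\<^sup>2) = (C\<^sub>0 / \<beta>\<^sup>2)\<^sup>2"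
      by (simp add: C_AALM_bg C_comp_tau_bg)
    have pos: "C\<^sub>0 / \<beta>\<^sup>2 > 0" using C\<^sub>0_pos \<beta> by simp
    have ne: "(C_AALM \<kappa> a \<beta> v (point 0))\<^sup>2 - \<alpha> / 4 * (\<Sum>j\<in>UNIV. (C_comp \<kappa> a \<beta> (tau j) v (point 0))\<^sup>2) \<noteq> 0"
      unfolding F0 using C\<^sub>0_pos \<beta> by simp
    have "sgn (X\<^sup>2) * (2 * X * Y) / (2 * sqrt \<bar>X\<^sup>2\<bar>) = Y" if "X > 0" for X Y :: real
      using that by simp
    from this [OF pos, of "C_var v / \<beta>\<^sup>2"]
    show ?thesis
      using has_real_derivative_sqrt_abs [OF F ne] by (simp only: F0)
  qed
  thus ?thesis
    unfolding H_dust_def sum_divide_distrib by (intro DERIV_sum)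
qed

lemma H_scalar_deriv':
  "((\<lambda>x. H_scalar \<kappa> a \<beta> (point x)) has_real_derivative
     (c * p\<^sup>2 * flux_tot / (2 * V\<^sub>0) * C\<^sub>0 + V\<^sub>0 * (\<Sum>v\<in>UNIV. C_var v)) / (2 * \<beta> * sqrt (V\<^sub>0 * C\<^sub>0))) (at 0)"
proof -
  define D where "D v = (c * p\<^sup>2 * avg_trace v / (2 * V\<^sub>0) * C\<^sub>0 + V\<^sub>0 * C_var v) / (2 * \<beta> * sqrt (V\<^sub>0 * C\<^sub>0))" for v
  have "((\<lambda>x. sqrt \<bar>vol a \<beta> v (point x) * C_AALM \<kappa> a \<beta> v (point x)\<bar>) has_real_derivative D v) (at 0)" for v
  proof -
    have F: "((\<lambda>x. vol a \<beta> v (point x) * C_AALM \<kappa> a \<beta> v (point x)) has_real_derivative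
       - (c * p\<^sup>2 * avg_trace v / (2 * V\<^sub>0) * C\<^sub>0 + V\<^sub>0 * C_var v) / \<beta>\<^sup>2) (at 0)"
      using \<beta> V\<^sub>0_pos by (auto intro!: derivative_eq_intros C_AALM_deriv vol_deriv simp: C_AALM_bg vol_bg field_simps)
    have F0: "vol a \<beta> v (point 0) * C_AALM \<kappa> a \<beta> v (point 0) = - (V\<^sub>0 * C\<^sub>0 / \<beta>\<^sup>2)"
      by (simp add: C_AALM_bg vol_bg)
    have pos: "V\<^sub>0 * C\<^sub>0 > 0" "V\<^sub>0 * C\<^sub>0 / \<beta>\<^sup>2 > 0" using C\<^sub>0_pos V\<^sub>0_pos \<beta> by simp_all
    \<comment> \<open>The product of volume and constraint is negative at the background; the sign
      from the absolute value cancels the minus in its variation.\<close>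
    have "sgn (- (V\<^sub>0 * C\<^sub>0 / \<beta>\<^sup>2)) = -1" "\<bar>- (V\<^sub>0 * C\<^sub>0 / \<beta>\<^sup>2)\<bar> = V\<^sub>0 * C\<^sub>0 / \<beta>\<^sup>2"
      using pos(2) by (simp_all only: sgn_minus sgn_pos abs_minus_cancel abs_of_pos)
    moreover have "sqrt (V\<^sub>0 * C\<^sub>0 / \<beta>\<^sup>2) = sqrt (V\<^sub>0 * C\<^sub>0) / \<beta>"
      using \<beta> by (simp add: real_sqrt_divide)
    moreover have "-1 * (- N / \<beta>\<^sup>2) / (2 * (R / \<beta>)) = N / (2 * \<beta> * R)" for N R
      using \<beta> by (simp add: power2_eq_square)
    moreover have ne: "vol a \<beta> v (point 0) * C_AALM \<kappa> a \<beta> v (point 0) \<noteq> 0"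
      unfolding F0 using pos(2) by linarith
    ultimately show ?thesis
      using has_real_derivative_sqrt_abs [OF F ne] by (simp only: F0 D_def)
  qed
  hence "((\<lambda>x. H_scalar \<kappa> a \<beta> (point x)) has_real_derivative (\<Sum>v\<in>UNIV. D v)) (at 0)"
    unfolding H_scalar_def by (intro DERIV_sum)
  moreover have "(\<Sum>v\<in>UNIV. D v) = (c * p\<^sup>2 * flux_tot / (2 * V\<^sub>0) * C\<^sub>0 + V\<^sub>0 * (\<Sum>v\<in>UNIV. C_var v)) / (2 * \<beta> * sqrt (V\<^sub>0 * C\<^sub>0))"
    by (simp add: D_def sum_avg_trace [symmetric] sum_divide_distrib sum_distrib_left sum_distrib_right sum.distrib add_divide_distrib)
  ultimately show ?thesis by simp
qed

section \<open>Explicit constants in the derivatives of the Hamiltonians\<close>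

lemma K_eq: "K = \<beta>\<^sup>2 * a ^ 4 / (6 * \<kappa>)"
  using \<beta> a \<kappa> by (simp add: K_def c_def field_simps power2_eq_square power3_eq_cube power4_eq_xxxx)

lemma V\<^sub>0_eq: "V\<^sub>0 = \<beta> * a ^ 3 * p * sqrt (2 * \<beta> * p) / 4"
proof -
  have "c * p ^ 3 = (\<beta> * a ^ 3 * p * sqrt (2 * \<beta> * p) / 4)\<^sup>2"
    using \<beta> p by (simp add: c_def power_mult_distrib power_divide) (simp add: field_simps power_numeral_reduce)
  thus ?thesis using \<beta> p a by (simp add: V\<^sub>0_def)
qed

lemma H_dust_deriv:
  "((\<lambda>x. H_dust \<kappa> a \<beta> \<alpha> (point x)) has_real_derivative
     a\<^sup>2 / \<kappa> * (4 / (3 * \<beta>\<^sup>2 * a) * (4 * sqrt (2 * \<beta> * p) * sin \<theta> * angle_tot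
       + \<beta> / sqrt (2 * \<beta> * p) * (sin \<theta>)\<^sup>2 * flux_tot))) (at 0)"
proof -
  define r where "r = sqrt (2 * \<beta> * p)"
  \<comment> \<open>Replacing \<open>p\<close> by \<open>r * r / (2 * \<beta>)\<close> turns the
    claim into an identity of rational functions, without square roots.\<close>
  have r: "r > 0" "p = r * r / (2 * \<beta>)" using \<beta> p by (simp_all add: r_def)
  have "(\<Sum>v\<in>UNIV. C_var v) / \<beta>\<^sup>2 = a\<^sup>2 / \<kappa> * (4 / (3 * \<beta>\<^sup>2 * a) * (4 * r * sin \<theta> * angle_tot
       + \<beta> / r * (sin \<theta>)\<^sup>2 * flux_tot))"
    unfolding sum_C_var K_eq V\<^sub>0_eq r_def [symmetric] unfolding r(2) using \<beta> a \<kappa> r(1)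
    by (simp add: divide_simps)
       (simp add: power2_eq_square power3_eq_cube power4_eq_xxxx algebra_simps)
  thus ?thesis using H_dust_deriv' by (simp add: r_def)
qed

lemma H_scalar_deriv:
  "((\<lambda>x. H_scalar \<kappa> a \<beta> (point x)) has_real_derivative
     a\<^sup>2 / \<kappa> * (sqrt (2 * \<kappa>) / 3 * (2 * p * sgn (sin \<theta>) * angle_tot + \<bar>sin \<theta>\<bar> * flux_tot))) (at 0)"
proof -
  define q where "q = sqrt (2 * \<kappa>)"
  define S where "S = \<bar>sin \<theta>\<bar>"
  have q: "q > 0" "\<kappa> = q * q / 2" using \<kappa> by (simp_all add: q_def)
  \<comment> \<open>The sign of \<open>sin \<theta>\<close> is split off: the root of its square
    produces \<open>S\<close>, while the angle term is linear in \<open>sin \<theta>\<close> and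
    retains the sign.\<close>
  have S: "S > 0" "sin \<theta> = sgn (sin \<theta>) * S" "(sin \<theta>)\<^sup>2 = S * S"
    using sin by (simp_all add: S_def sgn_mult_abs power2_eq_square)
  have "V\<^sub>0 * C\<^sub>0 = 12 * K * p\<^sup>2 * (S * S)"
    using V\<^sub>0_pos by (simp add: C\<^sub>0_def S(3))
  also have "\<dots> = (2 * \<beta> * a\<^sup>2 * p * S / q)\<^sup>2"
    unfolding K_eq unfolding q(2) using q(1)
    by (simp add: divide_simps) (simp add: power2_eq_square power4_eq_xxxx algebra_simps)
  finally have "sqrt (V\<^sub>0 * C\<^sub>0) = sqrt ((2 * \<beta> * a\<^sup>2 * p * S / q)\<^sup>2)"
    by (simp only:)
  moreover have "2 * \<beta> * a\<^sup>2 * p * S / q > 0"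
    using \<beta> a p q(1) S(1) by simp
  ultimately have sq: "sqrt (V\<^sub>0 * C\<^sub>0) = 2 * \<beta> * a\<^sup>2 * p * S / q"
    by (simp only: real_sqrt_abs abs_of_pos)
  have 1: "c * p\<^sup>2 * flux_tot / (2 * V\<^sub>0) * C\<^sub>0 = 6 * K * p * (S * S) * flux_tot"
  proof -
    have "c * p\<^sup>2 * flux_tot / (2 * V\<^sub>0) * C\<^sub>0 = 6 * K * (c * p ^ 4) * (S * S) * flux_tot / V\<^sub>0\<^sup>2"
      by (simp add: C\<^sub>0_def S(3) [symmetric] power2_eq_square power4_eq_xxxx)
    also have "\<dots> = 6 * K * p * (S * S) * flux_tot"
      unfolding V\<^sub>0_sq using c_pos p by (simp add: divide_simps power3_eq_cube power4_eq_xxxx)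
    finally show ?thesis .
  qed
  have 2: "V\<^sub>0 * (\<Sum>v\<in>UNIV. C_var v) = K * (16 * p\<^sup>2 * (sgn (sin \<theta>) * S) * angle_tot + 2 * p * (S * S) * flux_tot)"
    unfolding sum_C_var S(3) S(2) [symmetric] using V\<^sub>0_pos by simp
  have "(c * p\<^sup>2 * flux_tot / (2 * V\<^sub>0) * C\<^sub>0 + V\<^sub>0 * (\<Sum>v\<in>UNIV. C_var v)) / (2 * \<beta> * sqrt (V\<^sub>0 * C\<^sub>0))
     = a\<^sup>2 / \<kappa> * (q / 3 * (2 * p * sgn (sin \<theta>) * angle_tot + S * flux_tot))"
    unfolding 1 2 sq K_eq unfolding q(2) using \<beta> a q(1) S(1) p
    by (simp add: divide_simps)
       (simp add: power2_eq_square power3_eq_cube power4_eq_xxxx algebra_simps)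
  thus ?thesis using H_scalar_deriv' by (simp add: q_def S_def)
qed

end

section \<open>Single-edge perturbations\<close>

lemma has_vector_derivative_single:
  assumes "(f has_vector_derivative f') (at x)"
  shows "((\<lambda>t. if e = e' then f t else g) has_vector_derivative (if e = e' then f' else 0)) (at x)"
  using assms by (simp add: has_vector_derivative_const)

lemma sum_single_edge:
  fixes e :: "'l::nontriv edge" and g :: "'b::comm_monoid_add"
  shows "(\<Sum>v\<in>UNIV. if (v, I) = e then g else 0) = (if I = snd e then g else 0)"
  by (cases e) auto

text \<open>The unit quaternion of the exponential of half of \<open>su2_vec w\<close>. At
  \<open>w = 0\<close> the vector part is 0 because \<open>w\<close> itself vanishes, whatever the
  quotient.\<close>

definition qexp :: "real^3 \<Rightarrow> quat" where
  "qexp w = (cos (norm w / 2), (sin (norm w / 2) / norm w) *\<^sub>R w)"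

lemma mexp_half_su2_vec: "mexp ((1 / 2) *\<^sub>R su2_vec w) = qmat (qexp w)"
  by (simp add: su2_vec_scaleR [symmetric] mexp_su2_vec qexp_def)

lemma norm_qexp: "norm (qexp w) = 1"
  by (cases "w = 0") (simp_all add: qexp_def norm_Pair)

lemma qexp_axis: "qexp (x *\<^sub>R axis I 1) = (cos (x / 2), sin (x / 2) *\<^sub>R axis I 1)"
  by (simp add: qexp_def abs_real_def)

definition single_edge_point :: "real \<Rightarrow> real \<Rightarrow> 'l edge \<Rightarrow> quat \<Rightarrow> real^3 \<Rightarrow> 'l phase" where
  "single_edge_point \<theta> p e g w =
    phase_of (\<lambda>e'. if e' = e then g else qexp (\<theta> *\<^sub>R axis (snd e') 1))
      (\<lambda>e'. if e' = e then w else p *\<^sub>R axis (snd e') 1)"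

lemma perturbed_phase_of:
  "perturbed \<theta> p dp_par dp_perp dth_par dth_perp =
    phase_of (\<lambda>e. qexp ((\<theta> + dth_par e) *\<^sub>R axis (snd e) 1 + dth_perp e))
      (\<lambda>e. (p + dp_par e) *\<^sub>R axis (snd e) 1 + dp_perp e)"
  by (simp add: perturbed_def phase_of_def mexp_half_su2_vec)

lemma perturbed_single:
  fixes e :: "'l edge"
  shows "perturbed \<theta> p (no_pert(e := x)) no_pert no_pert no_pert =
      single_edge_point \<theta> p e (qexp (\<theta> *\<^sub>R axis (snd e) 1)) ((p + x) *\<^sub>R axis (snd e) 1)"
    and "perturbed \<theta> p no_pert no_pert (no_pert(e := x)) no_pert =
      single_edge_point \<theta> p e (qexp ((\<theta> + x) *\<^sub>R axis (snd e) 1)) (p *\<^sub>R axis (snd e) 1)"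
    and "perturbed \<theta> p no_pert (no_pert(e := w)) no_pert no_pert =
      single_edge_point \<theta> p e (qexp (\<theta> *\<^sub>R axis (snd e) 1)) (p *\<^sub>R axis (snd e) 1 + w)"
    and "perturbed \<theta> p no_pert no_pert no_pert (no_pert(e := w)) =
      single_edge_point \<theta> p e (qexp (\<theta> *\<^sub>R axis (snd e) 1 + w)) (p *\<^sub>R axis (snd e) 1)"
  unfolding perturbed_phase_of single_edge_point_def
  by (auto intro!: arg_cong2 [of _ _ _ _ phase_of] simp: fun_eq_iff)

text \<open>All four kinds of perturbation at one edge are instances. The velocities are supported
  on \<open>e\<close>, so \<open>angle_tot\<close> and \<open>flux_tot\<close> reduce to expressions
  at that edge.\<close>

locale single_edge_curve =
  fixes \<kappa> a \<beta> \<theta> p :: real and e :: "'l::nontriv edge"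
    and g :: "real \<Rightarrow> quat" and w :: "real \<Rightarrow> real^3" and g' :: quat and w' :: "real^3"
  assumes pos: "\<kappa> > 0" "a > 0" "\<beta> > 0" "p > 0" and sin: "sin \<theta> \<noteq> 0"
    and unit: "\<And>x. norm (g x) = 1"
    and g0: "g 0 = qexp (\<theta> *\<^sub>R axis (snd e) 1)" and w0: "w 0 = p *\<^sub>R axis (snd e) 1"
    and dg: "(g has_vector_derivative g') (at 0)" and dw: "(w has_vector_derivative w') (at 0)"
begin

sublocale lattice_curve \<kappa> a \<beta> \<theta> p
  "\<lambda>x e'. if e' = e then g x else qexp (\<theta> *\<^sub>R axis (snd e') 1)"
  "\<lambda>x e'. if e' = e then w x else p *\<^sub>R axis (snd e') 1"
  "\<lambda>e'. if e' = e then g' else 0" "\<lambda>e'. if e' = e then w' else 0"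
  by unfold_locales
     (auto simp: pos sin unit norm_Pair g0 w0 qexp_axis intro!: has_vector_derivative_single dg dw)

lemma angle_tot_single:
  "angle_tot = sin (\<theta> / 2) * fst g' + cos (\<theta> / 2) * snd g' $ snd e"
proof -
  have "G_tot I = (if I = snd e then g' else 0)" for I
    by (simp only: G_tot_def sum_single_edge)
  hence "angle_tot = (\<Sum>I\<in>UNIV. if I = snd e then si * fst g' + co * snd g' $ I else 0)"
    unfolding angle_tot_def by (intro sum.cong) simp_all
  thus ?thesis by (simp add: co_def si_def)
qed

lemma flux_tot_single: "flux_tot = w' $ snd e"
proof -
  have "(\<Sum>v\<in>UNIV. (if (v, I) = e then w' else 0) $ I) = (if I = snd e then w' $ I else 0)" for I
    using sum_single_edge [of I e "w' $ I"] by (simp add: if_distrib [of "\<lambda>x. x $ I"] cong: if_cong)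
  thus ?thesis by (simp add: flux_tot_def)
qed

lemma point_single: "point x = single_edge_point \<theta> p e (g x) (w x)"
  by (simp add: point_def single_edge_point_def)

lemmas H_dust_single = H_dust_deriv [unfolded point_single angle_tot_single flux_tot_single]
lemmas H_scalar_single = H_scalar_deriv [unfolded point_single angle_tot_single flux_tot_single]

end

section \<open>Velocities of the perturbed holonomies and fluxes\<close>

lemma axis_zero: "axis b (0::real) = 0"
  by (simp add: vec_eq_iff axis_def)

lemma axis_deriv: "((\<lambda>x. axis b x :: real^3) has_vector_derivative axis b 1) F"
proof -
  have "((\<lambda>x. x *\<^sub>R axis b (1::real)) has_vector_derivative 1 *\<^sub>R axis b 1) F"
    using bounded_linear.has_vector_derivative [OF bounded_linear_scaleR_left has_vector_derivative_id] by simp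
  thus ?thesis by (simp add: scaleR_axis)
qed

lemma qexp_parallel_deriv:
  "((\<lambda>x. qexp ((\<theta> + x) *\<^sub>R axis I 1)) has_vector_derivative
     (- sin (\<theta> / 2) / 2, (cos (\<theta> / 2) / 2) *\<^sub>R axis I 1)) (at 0)"
  unfolding qexp_axis
  by (intro has_vector_derivative_Pair has_vector_derivative_scaleR [where g' = 0, simplified])
     (auto intro!: derivative_eq_intros simp: has_real_derivative_iff_has_vector_derivative [symmetric])

text \<open>The length \<open>sqrt (\<theta>^2 + x^2)\<close> is stationary at \<open>x = 0\<close>,
  hence so are the cosine and the coefficient of the vector part; only the direction moves. The
  condition \<open>\<theta> \<noteq> 0\<close> keeps the root differentiable.\<close>

lemma qexp_perp_deriv:
  assumes "b \<noteq> I" and "\<theta> \<noteq> 0"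
  shows "((\<lambda>x. qexp (\<theta> *\<^sub>R axis I 1 + axis b x)) has_vector_derivative
     (0, (sin (\<theta> / 2) / \<theta>) *\<^sub>R axis b 1)) (at 0)"
proof -
  define n where "n x = sqrt (\<theta>\<^sup>2 + x\<^sup>2)" for x
  have n0: "n 0 = \<bar>\<theta>\<bar>" by (simp add: n_def)
  have norm: "norm (\<theta> *\<^sub>R axis I 1 + axis b x) = n x" for x
  proof -
    have "(norm (\<theta> *\<^sub>R axis I 1 + axis b x))\<^sup>2 = \<theta>\<^sup>2 + x\<^sup>2"
      unfolding power2_norm_eq_inner using assms
      by (simp add: inner_add_left inner_add_right inner_axis_axis power2_eq_square)
    from real_sqrt_unique [OF this norm_ge_zero] show ?thesis by (simp only: n_def)
  qed
  have dn: "(n has_real_derivative 0) (at 0)"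
    unfolding n_def using assms by (auto intro!: derivative_eq_intros)
  have 1: "((\<lambda>x. cos (n x / 2)) has_real_derivative 0) (at 0)"
    by (auto intro!: derivative_eq_intros dn)
  have 2: "((\<lambda>x. sin (n x / 2) / n x) has_real_derivative 0) (at 0)"
    using assms by (auto intro!: derivative_eq_intros dn simp: n0)
  have 3: "((\<lambda>x. \<theta> *\<^sub>R axis I 1 + axis b x) has_vector_derivative axis b 1) (at 0)"
    using has_vector_derivative_add [OF has_vector_derivative_const axis_deriv] by simp
  have sinc: "sin (n 0 / 2) / n 0 = sin (\<theta> / 2) / \<theta>"
    by (simp add: n0 abs_real_def)
  have "((\<lambda>x. (sin (n x / 2) / n x) *\<^sub>R (\<theta> *\<^sub>R axis I 1 + axis b x)) has_vector_derivative
     (sin (n 0 / 2) / n 0) *\<^sub>R axis b 1 + 0 *\<^sub>R (\<theta> *\<^sub>R axis I 1 + axis b 0)) (at 0)"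
    by (rule has_vector_derivative_scaleR [OF 2 3])
  hence "((\<lambda>x. (cos (n x / 2), (sin (n x / 2) / n x) *\<^sub>R (\<theta> *\<^sub>R axis I 1 + axis b x))) has_vector_derivative
     (0, (sin (\<theta> / 2) / \<theta>) *\<^sub>R axis b 1)) (at 0)"
    using 1 unfolding has_real_derivative_iff_has_vector_derivative sinc
    by (intro has_vector_derivative_Pair) simp_all
  thus ?thesis by (simp add: qexp_def norm)
qed

section \<open>The cosmological equations\<close>

text \<open>Uniqueness of derivatives reduces each existential to the given value, and
  \<open>a\<^sup>2 / \<kappa>\<close> cancels the factor in the evolution equations.\<close>

lemma evolution_eqs_iff:
  fixes H :: "'l::nontriv phase \<Rightarrow> real"
  assumes "\<And>e. has_partial_p_par H (\<theta> t) (p t) e (a\<^sup>2 / \<kappa> * P)"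
    and "\<And>e. has_partial_theta_par H (\<theta> t) (p t) e (a\<^sup>2 / \<kappa> * Q)"
    and "((\<lambda>q. f (\<theta> t) q) has_real_derivative P) (at (p t))"
    and "((\<lambda>u. f u (p t)) has_real_derivative Q) (at (\<theta> t))"
    and "a \<noteq> 0" "\<kappa> \<noteq> 0"
  shows "evolution_eqs \<kappa> a H \<theta> p t \<longleftrightarrow> reduced_eqs f \<theta> p t"
proof -
  have P: "has_partial_p_par H (\<theta> t) (p t) e D \<longleftrightarrow> D = a\<^sup>2 / \<kappa> * P" for e D
    using assms(1) [of e] unfolding has_partial_p_par_def by (metis DERIV_unique)
  have Q: "has_partial_theta_par H (\<theta> t) (p t) e D \<longleftrightarrow> D = a\<^sup>2 / \<kappa> * Q" for e D
    using assms(2) [of e] unfolding has_partial_theta_par_def by (metis DERIV_unique)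
  have "deriv (\<lambda>q. f (\<theta> t) q) (p t) = P" "deriv (\<lambda>u. f u (p t)) (\<theta> t) = Q"
    using assms(3,4) by (simp_all add: DERIV_imp_deriv)
  thus ?thesis
    using assms(5,6) by (simp add: evolution_eqs_def reduced_eqs_def P Q)
qed

section \<open>Partial derivatives of the two Hamiltonians\<close>

context
  fixes \<kappa> a \<beta> \<theta> p :: real
  assumes pos: "\<kappa> > 0" "a > 0" "\<beta> > 0" "p > 0" and sin: "sin \<theta> \<noteq> 0"
begin

text \<open>The choice \<open>b = snd e\<close> gives the parallel perturbation, any other
  \<open>b\<close> a perpendicular one.\<close>

lemma flux_curve:
  fixes e :: "'l::nontriv edge"
  shows "single_edge_curve \<kappa> a \<beta> \<theta> p e (\<lambda>x. qexp (\<theta> *\<^sub>R axis (snd e) 1))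
     (\<lambda>x. p *\<^sub>R axis (snd e) 1 + axis b x) 0 (axis b 1)"
proof -
  have "((\<lambda>x. p *\<^sub>R axis (snd e) 1 + axis b x) has_vector_derivative axis b 1) (at 0)"
    using has_vector_derivative_add [OF has_vector_derivative_const axis_deriv] by simp
  thus ?thesis
    by unfold_locales (simp_all add: pos sin norm_qexp has_vector_derivative_const axis_zero)
qed

lemma angle_par_curve:
  fixes e :: "'l::nontriv edge"
  shows "single_edge_curve \<kappa> a \<beta> \<theta> p e (\<lambda>x. qexp ((\<theta> + x) *\<^sub>R axis (snd e) 1))
     (\<lambda>x. p *\<^sub>R axis (snd e) 1) (- sin (\<theta> / 2) / 2, (cos (\<theta> / 2) / 2) *\<^sub>R axis (snd e) 1) 0"
  by unfold_locales (simp_all only: pos sin norm_qexp has_vector_derivative_const qexp_parallel_deriv add_0_right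
      not_False_eq_True)

lemma angle_perp_curve:
  fixes e :: "'l::nontriv edge"
  assumes "b \<noteq> snd e"
  shows "single_edge_curve \<kappa> a \<beta> \<theta> p e (\<lambda>x. qexp (\<theta> *\<^sub>R axis (snd e) 1 + axis b x))
     (\<lambda>x. p *\<^sub>R axis (snd e) 1) (0, (sin (\<theta> / 2) / \<theta>) *\<^sub>R axis b 1) 0"
proof -
  have "\<theta> \<noteq> 0" using sin by auto
  thus ?thesis
    by unfold_locales (simp_all add: assms pos sin norm_qexp has_vector_derivative_const qexp_perp_deriv axis_zero)
qed

text \<open>The derivative of
  \<open>sin (\<theta> / 2) * cos (\<theta> / 2) = sin \<theta> / 2\<close> along the parallel
  angle.\<close>

lemma angle_velocity:
  "sin (\<theta> / 2) * fst (- sin (\<theta> / 2) / 2, (cos (\<theta> / 2) / 2) *\<^sub>R axis I 1)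
    + cos (\<theta> / 2) * snd (- sin (\<theta> / 2) / 2, (cos (\<theta> / 2) / 2) *\<^sub>R axis I (1::real)) $ I = cos \<theta> / 2"
  using cos_double [of "\<theta> / 2"] by (simp add: power2_eq_square)

lemma scaleR_axis_shift: "(p + x) *\<^sub>R axis I 1 = p *\<^sub>R axis I 1 + axis I (x::real)"
  by (simp add: vec_eq_iff axis_def distrib_right)

text \<open>A parallel perturbation feeds exactly one of \<open>flux_tot\<close> and
  \<open>angle_tot\<close>. A perpendicular one feeds neither: its velocity is along
  \<open>axis b 1\<close>, without component \<open>snd e\<close>, and has no scalar part.\<close>

lemma partials_dust:
  fixes e :: "'l::nontriv edge"
  shows "has_partial_p_par (H_dust \<kappa> a \<beta> \<alpha>) \<theta> p e
      (a\<^sup>2 / \<kappa> * (4 / (3 * \<beta>\<^sup>2 * a) * (\<beta> / sqrt (2 * \<beta> * p) * (sin \<theta>)\<^sup>2)))"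
      (is "has_partial_p_par ?H _ _ _ ?P")
    and "has_partial_theta_par (H_dust \<kappa> a \<beta> \<alpha>) \<theta> p e
      (a\<^sup>2 / \<kappa> * (4 / (3 * \<beta>\<^sup>2 * a) * (sqrt (2 * \<beta> * p) * (2 * sin \<theta> * cos \<theta>))))"
      (is "has_partial_theta_par _ _ _ _ ?Q")
    and "b \<noteq> snd e \<Longrightarrow> has_partial_p_perp (H_dust \<kappa> a \<beta> \<alpha>) \<theta> p e b 0"
    and "b \<noteq> snd e \<Longrightarrow> has_partial_theta_perp (H_dust \<kappa> a \<beta> \<alpha>) \<theta> p e b 0"
proof -
  show "has_partial_p_par ?H \<theta> p e ?P"
    unfolding has_partial_p_par_def perturbed_single scaleR_axis_shift
    by (rule DERIV_cong, rule single_edge_curve.H_dust_single [OF flux_curve]) simp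
  show "has_partial_theta_par ?H \<theta> p e ?Q"
    unfolding has_partial_theta_par_def perturbed_single
    by (rule DERIV_cong, rule single_edge_curve.H_dust_single [OF angle_par_curve, unfolded angle_velocity]) simp
  assume b: "b \<noteq> snd e"
  show "has_partial_p_perp ?H \<theta> p e b 0"
    unfolding has_partial_p_perp_def perturbed_single
    by (rule DERIV_cong, rule single_edge_curve.H_dust_single [OF flux_curve]) (simp add: axis_def b [symmetric])
  show "has_partial_theta_perp ?H \<theta> p e b 0"
    unfolding has_partial_theta_perp_def perturbed_single
    by (rule DERIV_cong, rule single_edge_curve.H_dust_single [OF angle_perp_curve [OF b]]) (simp add: axis_def b [symmetric])
qed

lemma partials_scalar:
  fixes e :: "'l::nontriv edge"
  shows "has_partial_p_par (H_scalar \<kappa> a \<beta>) \<theta> p e (a\<^sup>2 / \<kappa> * (sqrt (2 * \<kappa>) / 3 * \<bar>sin \<theta>\<bar>))"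
      (is "has_partial_p_par ?H _ _ _ ?P")
    and "has_partial_theta_par (H_scalar \<kappa> a \<beta>) \<theta> p e
      (a\<^sup>2 / \<kappa> * (sqrt (2 * \<kappa>) / 3 * (p * (sgn (sin \<theta>) * cos \<theta>))))"
      (is "has_partial_theta_par _ _ _ _ ?Q")
    and "b \<noteq> snd e \<Longrightarrow> has_partial_p_perp (H_scalar \<kappa> a \<beta>) \<theta> p e b 0"
    and "b \<noteq> snd e \<Longrightarrow> has_partial_theta_perp (H_scalar \<kappa> a \<beta>) \<theta> p e b 0"
proof -
  show "has_partial_p_par ?H \<theta> p e ?P"
    unfolding has_partial_p_par_def perturbed_single scaleR_axis_shift
    by (rule DERIV_cong, rule single_edge_curve.H_scalar_single [OF flux_curve]) simp
  show "has_partial_theta_par ?H \<theta> p e ?Q"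
    unfolding has_partial_theta_par_def perturbed_single
    by (rule DERIV_cong, rule single_edge_curve.H_scalar_single [OF angle_par_curve, unfolded angle_velocity]) simp
  assume b: "b \<noteq> snd e"
  show "has_partial_p_perp ?H \<theta> p e b 0"
    unfolding has_partial_p_perp_def perturbed_single
    by (rule DERIV_cong, rule single_edge_curve.H_scalar_single [OF flux_curve]) (simp add: axis_def b [symmetric])
  show "has_partial_theta_perp ?H \<theta> p e b 0"
    unfolding has_partial_theta_perp_def perturbed_single
    by (rule DERIV_cong, rule single_edge_curve.H_scalar_single [OF angle_perp_curve [OF b]]) (simp add: axis_def b [symmetric])
qed

end

section \<open>Comparison with the reduced Hamilton equations\<close>

lemma dust_equations:
  fixes \<theta> p :: "real \<Rightarrow> real"
  assumes "\<kappa> > 0" "a > 0" "\<beta> > 0" "p t > 0" "sin (\<theta> t) \<noteq> 0"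
  shows "evolution_eqs \<kappa> a (H_dust \<kappa> a \<beta> \<alpha> :: 'l::nontriv phase \<Rightarrow> real) \<theta> p t \<longleftrightarrow>
      reduced_eqs (\<lambda>u q. 4 / (3 * \<beta>\<^sup>2 * a) * sqrt (2 * \<beta> * q) * (sin u)\<^sup>2) \<theta> p t"
    and "constraint_eqs (H_dust \<kappa> a \<beta> \<alpha> :: 'l phase \<Rightarrow> real) (\<theta> t) (p t)"
proof -
  note partials = partials_dust [OF assms, where 'l = 'l]
  show "evolution_eqs \<kappa> a (H_dust \<kappa> a \<beta> \<alpha> :: 'l phase \<Rightarrow> real) \<theta> p t \<longleftrightarrow>
      reduced_eqs (\<lambda>u q. 4 / (3 * \<beta>\<^sup>2 * a) * sqrt (2 * \<beta> * q) * (sin u)\<^sup>2) \<theta> p t"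
  proof (rule evolution_eqs_iff [where P = "4 / (3 * \<beta>\<^sup>2 * a) * (\<beta> / sqrt (2 * \<beta> * p t) * (sin (\<theta> t))\<^sup>2)" and
        Q = "4 / (3 * \<beta>\<^sup>2 * a) * (sqrt (2 * \<beta> * p t) * (2 * sin (\<theta> t) * cos (\<theta> t)))"], rule partials(1), rule partials(2))
    show "((\<lambda>q. 4 / (3 * \<beta>\<^sup>2 * a) * sqrt (2 * \<beta> * q) * (sin (\<theta> t))\<^sup>2) has_real_derivative
      4 / (3 * \<beta>\<^sup>2 * a) * (\<beta> / sqrt (2 * \<beta> * p t) * (sin (\<theta> t))\<^sup>2)) (at (p t))"
    proof -
      have "((\<lambda>q. sqrt (2 * \<beta> * q)) has_real_derivative \<beta> / sqrt (2 * \<beta> * p t)) (at (p t))"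
        using assms by (auto intro!: derivative_eq_intros simp: divide_simps mult_less_0_iff)
      from DERIV_cmult [OF DERIV_cmult_right [OF this, of "(sin (\<theta> t))\<^sup>2"], of "4 / (3 * \<beta>\<^sup>2 * a)"]
      show ?thesis by (simp only: mult.assoc)
    qed
    show "((\<lambda>u. 4 / (3 * \<beta>\<^sup>2 * a) * sqrt (2 * \<beta> * p t) * (sin u)\<^sup>2) has_real_derivative
      4 / (3 * \<beta>\<^sup>2 * a) * (sqrt (2 * \<beta> * p t) * (2 * sin (\<theta> t) * cos (\<theta> t)))) (at (\<theta> t))"
    proof -
      have "((\<lambda>u. (sin u)\<^sup>2) has_real_derivative 2 * sin (\<theta> t) * cos (\<theta> t)) (at (\<theta> t))"
        by (auto intro!: derivative_eq_intros)
      from DERIV_cmult [OF DERIV_cmult [OF this, of "sqrt (2 * \<beta> * p t)"], of "4 / (3 * \<beta>\<^sup>2 * a)"]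
      show ?thesis by (simp only: mult.assoc)
    qed
  qed (use assms in simp_all)
  show "constraint_eqs (H_dust \<kappa> a \<beta> \<alpha> :: 'l phase \<Rightarrow> real) (\<theta> t) (p t)"
    using partials(3,4) by (simp add: constraint_eqs_def)
qed

lemma scalar_equations:
  fixes \<theta> p :: "real \<Rightarrow> real"
  assumes "\<kappa> > 0" "a > 0" "\<beta> > 0" "p t > 0" "sin (\<theta> t) \<noteq> 0"
  shows "evolution_eqs \<kappa> a (H_scalar \<kappa> a \<beta> :: 'l::nontriv phase \<Rightarrow> real) \<theta> p t \<longleftrightarrow>
      reduced_eqs (\<lambda>u q. sqrt (2 * \<kappa>) * q / 3 * sqrt ((sin u)\<^sup>2)) \<theta> p t"
    and "constraint_eqs (H_scalar \<kappa> a \<beta> :: 'l phase \<Rightarrow> real) (\<theta> t) (p t)"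
proof -
  note partials = partials_scalar [OF assms, where 'l = 'l]
  show "evolution_eqs \<kappa> a (H_scalar \<kappa> a \<beta> :: 'l phase \<Rightarrow> real) \<theta> p t \<longleftrightarrow>
      reduced_eqs (\<lambda>u q. sqrt (2 * \<kappa>) * q / 3 * sqrt ((sin u)\<^sup>2)) \<theta> p t"
  proof (rule evolution_eqs_iff [where P = "sqrt (2 * \<kappa>) / 3 * \<bar>sin (\<theta> t)\<bar>" and
        Q = "sqrt (2 * \<kappa>) / 3 * (p t * (sgn (sin (\<theta> t)) * cos (\<theta> t)))"], rule partials(1), rule partials(2))
    have "((\<lambda>q. sqrt (2 * \<kappa>) / 3 * \<bar>sin (\<theta> t)\<bar> * q) has_real_derivative sqrt (2 * \<kappa>) / 3 * \<bar>sin (\<theta> t)\<bar>) (at (p t))"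
      using DERIV_cmult [OF DERIV_ident, of "sqrt (2 * \<kappa>) / 3 * \<bar>sin (\<theta> t)\<bar>"] by simp
    thus "((\<lambda>q. sqrt (2 * \<kappa>) * q / 3 * sqrt ((sin (\<theta> t))\<^sup>2)) has_real_derivative
      sqrt (2 * \<kappa>) / 3 * \<bar>sin (\<theta> t)\<bar>) (at (p t))"
      by (simp add: mult_ac)
    \<comment> \<open>The redundant absolute value brings the function into the form of
      \<open>has_real_derivative_sqrt_abs\<close>; it is removed again by
      \<open>abs_power2\<close>.\<close>
    have "((\<lambda>u. sqrt \<bar>(sin u)\<^sup>2\<bar>) has_real_derivative
        sgn ((sin (\<theta> t))\<^sup>2) * (2 * sin (\<theta> t) * cos (\<theta> t)) / (2 * sqrt \<bar>(sin (\<theta> t))\<^sup>2\<bar>)) (at (\<theta> t))"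
      using assms by (intro has_real_derivative_sqrt_abs) (auto intro!: derivative_eq_intros)
    also have "sgn ((sin (\<theta> t))\<^sup>2) * (2 * sin (\<theta> t) * cos (\<theta> t)) / (2 * sqrt \<bar>(sin (\<theta> t))\<^sup>2\<bar>) = sgn (sin (\<theta> t)) * cos (\<theta> t)"
      using assms by (simp add: sgn_if abs_if)
    finally have "((\<lambda>u. sqrt ((sin u)\<^sup>2)) has_real_derivative sgn (sin (\<theta> t)) * cos (\<theta> t)) (at (\<theta> t))"
      by (simp only: abs_power2)
    from DERIV_cmult [OF DERIV_cmult [OF this, of "p t"], of "sqrt (2 * \<kappa>) / 3"]
    show "((\<lambda>u. sqrt (2 * \<kappa>) * p t / 3 * sqrt ((sin u)\<^sup>2)) has_real_derivative
      sqrt (2 * \<kappa>) / 3 * (p t * (sgn (sin (\<theta> t)) * cos (\<theta> t)))) (at (\<theta> t))"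
      by (simp add: mult.assoc)
  qed (use assms in simp_all)
  show "constraint_eqs (H_scalar \<kappa> a \<beta> :: 'l phase \<Rightarrow> real) (\<theta> t) (p t)"
    using partials(3,4) by (simp add: constraint_eqs_def)
qed

theorem theorem6p3:
  fixes \<kappa> a \<beta> :: real and T :: "real set" and \<theta> p :: "real \<Rightarrow> real"
  assumes "\<kappa> > 0" and "a > 0" and "\<beta> > 0"
    and "open T" and "is_interval T"
    and "\<And>t. t \<in> T \<Longrightarrow> \<theta> differentiable (at t)"
    and "\<And>t. t \<in> T \<Longrightarrow> p differentiable (at t)"
    and "\<And>t. t \<in> T \<Longrightarrow> p t > 0"
    and "\<And>t. t \<in> T \<Longrightarrow> sin (\<theta> t) \<noteq> 0"
  shows
    "(\<forall>\<alpha>\<in>{1, 0}.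
        ((\<forall>t\<in>T. evolution_eqs \<kappa> a (H_dust \<kappa> a \<beta> \<alpha> :: 'l::nontriv phase \<Rightarrow> real) \<theta> p t)
         \<longleftrightarrow> (\<forall>t\<in>T. reduced_eqs
               (\<lambda>u q. 4 / (3 * \<beta>\<^sup>2 * a) * sqrt (2 * \<beta> * q) * (sin u)\<^sup>2) \<theta> p t)) \<and>
        (\<forall>t\<in>T. constraint_eqs (H_dust \<kappa> a \<beta> \<alpha> :: 'l phase \<Rightarrow> real) (\<theta> t) (p t)))
     \<and>
     (((\<forall>t\<in>T. evolution_eqs \<kappa> a (H_scalar \<kappa> a \<beta> :: 'l phase \<Rightarrow> real) \<theta> p t)
       \<longleftrightarrow> (\<forall>t\<in>T. reduced_eqs
             (\<lambda>u q. sqrt (2 * \<kappa>) * q / 3 * sqrt ((sin u)\<^sup>2)) \<theta> p t)) \<and>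
      (\<forall>t\<in>T. constraint_eqs (H_scalar \<kappa> a \<beta> :: 'l phase \<Rightarrow> real) (\<theta> t) (p t)))"
  using assms by (simp add: dust_equations scalar_equations)

end
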